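(* Let $G$ be a finitely generated group with the word length metric. Then $G$ has exactly one end if and only if its Higson corona $\nu G$ is a decomposable continuum.
   Context: The word length metric on $G$ is taken with respect to a finite generating set; with it $G$ is a proper metric space. Ends: a proper ray in a metric space $X$ is a proper continuous map $r:[0,\infty)\to X$. Two proper rays $r_1,r_2$ define the same end of $X$ if for every compact $K\subset X$ there is $N\in\mathbb{N}$ such that $r_1([N,\infty))$ and $r_2([N,\infty))$ are contained in the same path component of $X\setminus K$. This is an equivalence relation, and an end of $X$ is an equivalence class of proper rays. The number of ends of a finitely generated group $G$ is the number of ends of its Cayley graph with respect to a finite generating set (it does not depend on the choice of finite generating set). Higson corona: for a proper metric space $X$ with closed balls $B(x,r)$, let $C_H(X)$ be the set of bounded continuous functions $f:X\to\mathbb{R}$ such that for all $r>0$ and $\varepsilon>0$ there is a compact $K\subset X$ with $\operatorname{diam} f(B(x,r))<\varepsilon$ for all $x\in X\setminus K$. The evaluation map $e:X\to\prod_{f\in C_H(X)}[\inf f,\sup f]$, $(e(x))_f=f(x)$, is a topological embedding; the Higson compactification $X^\nu$ is the closure of $e(X)$ (with $X$ identified with $e(X)$), and the Higson corona is $\nu X=X^\nu\setminus X$. A continuum is a non-empty compact connected Hausdorff space; it is decomposable if it is the union of two of its proper subcontinua (subcontinua not equal to the whole space). *)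

theory Defs
  imports "HOL-Analysis.Analysis" "HOL-Algebra.Generated_Groups"
begin

section \<open>Continua\<close>

definition continuum :: "'a topology \<Rightarrow> bool" where
  "continuum X \<longleftrightarrow>
     topspace X \<noteq> {} \<and> compact_space X \<and> connected_space X \<and> Hausdorff_space X"

definition decomposable :: "'a topology \<Rightarrow> bool" where
  "decomposable X \<longleftrightarrow>
     (\<exists>A B. A \<subset> topspace X \<and> B \<subset> topspace X \<and>
            continuum (subtopology X A) \<and> continuum (subtopology X B) \<and>
            A \<union> B = topspace X)"


section \<open>Ends\<close>

text \<open>Rays are total functions on the reals of which only the values on \<open>[0,\<infinity>)\<close> matter:
  functions agreeing there are related by \<open>same_end\<close>, so they give the same end.\<close>

definition proper_ray :: "'a topology \<Rightarrow> (real \<Rightarrow> 'a) \<Rightarrow> bool" where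
  "proper_ray X r \<longleftrightarrow>
     continuous_map (top_of_set {0..}) X r \<and> proper_map (top_of_set {0..}) X r"

definition same_end :: "'a topology \<Rightarrow> (real \<Rightarrow> 'a) \<Rightarrow> (real \<Rightarrow> 'a) \<Rightarrow> bool" where
  "same_end X r\<^sub>1 r\<^sub>2 \<longleftrightarrow>
     (\<forall>K. compactin X K \<longrightarrow>
        (\<exists>N::nat. \<exists>C \<in> path_components_of (subtopology X (topspace X - K)).
           r\<^sub>1 ` {real N..} \<subseteq> C \<and> r\<^sub>2 ` {real N..} \<subseteq> C))"

definition ends_of_space :: "'a topology \<Rightarrow> (real \<Rightarrow> 'a) set set" where
  "ends_of_space X =
     {r. proper_ray X r} // {(r\<^sub>1, r\<^sub>2). proper_ray X r\<^sub>1 \<and> proper_ray X r\<^sub>2 \<and> same_end X r\<^sub>1 r\<^sub>2}"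


section \<open>The Higson corona\<close>

context Metric_space
begin

text \<open>The functions are taken in \<open>extensional M\<close> so that they correspond bijectively to
  functions on the space \<open>M\<close>.\<close>

definition higson_functions :: "('a \<Rightarrow> real) set" where
  "higson_functions =
     {f \<in> extensional M. continuous_map mtopology euclideanreal f \<and> bounded (f ` M) \<and>
        (\<forall>r>0. \<forall>\<epsilon>>0. \<exists>K. compactin mtopology K \<and>
           (\<forall>x \<in> M - K. diameter (f ` mcball x r) < \<epsilon>))}"

definition higson_product :: "(('a \<Rightarrow> real) \<Rightarrow> real) topology" where
  "higson_product =
     product_topology (\<lambda>f. top_of_set {Inf (f ` M)..Sup (f ` M)}) higson_functions"

definition higson_evaluation :: "'a \<Rightarrow> ('a \<Rightarrow> real) \<Rightarrow> real" where
  "higson_evaluation x = (\<lambda>f\<in>higson_functions. f x)"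

definition higson_compactification :: "(('a \<Rightarrow> real) \<Rightarrow> real) topology" where
  "higson_compactification =
     subtopology higson_product (higson_product closure_of (higson_evaluation ` M))"

definition higson_corona :: "(('a \<Rightarrow> real) \<Rightarrow> real) topology" where
  "higson_corona =
     subtopology higson_compactification
       (topspace higson_compactification - higson_evaluation ` M)"

end


section \<open>Word metric and Cayley graph\<close>

text \<open>The locale \<open>Metric_space\<close> demands nonnegativity and symmetry of the distance function also
  outside of the carrier, so both metrics below are set to 0 there.\<close>

definition word_length :: "('a, 'b) monoid_scheme \<Rightarrow> 'a set \<Rightarrow> 'a \<Rightarrow> nat" where
  "word_length G S g =
     (LEAST n. \<exists>ws. length ws = n \<and> set ws \<subseteq> S \<union> m_inv G ` S \<and>
                    foldr (mult G) ws \<one>\<^bsub>G\<^esub> = g)"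

definition word_dist :: "('a, 'b) monoid_scheme \<Rightarrow> 'a set \<Rightarrow> 'a \<Rightarrow> 'a \<Rightarrow> real" where
  "word_dist G S g h =
     (if g \<in> carrier G \<and> h \<in> carrier G
      then real (word_length G S (inv\<^bsub>G\<^esub> g \<otimes>\<^bsub>G\<^esub> h)) else 0)"

lemma (in group) foldr_mult_closed:
  "set ws \<subseteq> carrier G \<Longrightarrow> foldr (\<otimes>) ws \<one> \<in> carrier G"
  by (induction ws) auto

lemma (in group) foldr_mult_append:
  "set us \<subseteq> carrier G \<Longrightarrow> set ws \<subseteq> carrier G \<Longrightarrow>
   foldr (\<otimes>) (us @ ws) \<one> = foldr (\<otimes>) us \<one> \<otimes> foldr (\<otimes>) ws \<one>"
  by (induction us) (auto simp: foldr_mult_closed m_assoc simp del: foldr_append)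

lemma (in group) foldr_mult_inv:
  assumes "set ws \<subseteq> carrier G"
  shows "foldr (\<otimes>) (rev (map (m_inv G) ws)) \<one> = inv (foldr (\<otimes>) ws \<one>)"
  using assms
proof (induction ws)
  case (Cons a ws)
  then have "set (rev (map (m_inv G) ws)) \<subseteq> carrier G" by auto
  then have "foldr (\<otimes>) (rev (map (m_inv G) ws) @ [inv a]) \<one>
      = foldr (\<otimes>) (rev (map (m_inv G) ws)) \<one> \<otimes> foldr (\<otimes>) [inv a] \<one>"
    using Cons.prems by (intro foldr_mult_append) auto
  then show ?case
    using Cons by (auto simp: inv_mult_group foldr_mult_closed simp del: foldr_append)
qed auto

lemma (in group) word_exists:
  assumes "S \<subseteq> carrier G" "g \<in> generate G S"
  shows "\<exists>ws. set ws \<subseteq> S \<union> m_inv G ` S \<and> foldr (\<otimes>) ws \<one> = g"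
  using assms(2)
proof induction
  case one
  show ?case by (intro exI[of _ "[]"]) auto
next
  case (incl h)
  then show ?case using assms(1) by (intro exI[of _ "[h]"]) auto
next
  case (inv h)
  then show ?case using assms(1) by (intro exI[of _ "[inv h]"]) auto
next
  case (eng g h)
  then obtain us ws where *: "set us \<subseteq> S \<union> m_inv G ` S" "foldr (\<otimes>) us \<one> = g"
    "set ws \<subseteq> S \<union> m_inv G ` S" "foldr (\<otimes>) ws \<one> = h" by blast
  have "S \<union> m_inv G ` S \<subseteq> carrier G" using assms(1) by auto
  then have "foldr (\<otimes>) (us @ ws) \<one> = g \<otimes> h"
    using * foldr_mult_append[of us ws] by auto
  then show ?case using * by (intro exI[of _ "us @ ws"]) auto
qed

lemma (in group) word_length_le:
  assumes "set ws \<subseteq> S \<union> m_inv G ` S"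
  shows "word_length G S (foldr (\<otimes>) ws \<one>) \<le> length ws"
  unfolding word_length_def by (rule Least_le) (use assms in auto)

lemma (in group) shortest_word:
  assumes "S \<subseteq> carrier G" "generate G S = carrier G" "g \<in> carrier G"
  obtains ws where "set ws \<subseteq> S \<union> m_inv G ` S" "foldr (\<otimes>) ws \<one> = g"
    "length ws = word_length G S g"
proof -
  have "\<exists>n ws. length ws = n \<and> set ws \<subseteq> S \<union> m_inv G ` S \<and> foldr (\<otimes>) ws \<one> = g"
    using word_exists[of S g] assms by auto
  then show ?thesis
    using that unfolding word_length_def by (smt (verit, ccfv_threshold) LeastI_ex)
qed

lemma (in group) word_length_inv_le:
  assumes "S \<subseteq> carrier G" "generate G S = carrier G" "g \<in> carrier G"
  shows "word_length G S (inv g) \<le> word_length G S g"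
proof -
  obtain ws where ws: "set ws \<subseteq> S \<union> m_inv G ` S" "foldr (\<otimes>) ws \<one> = g"
    "length ws = word_length G S g" using shortest_word[OF assms] .
  have "set ws \<subseteq> carrier G" using ws(1) assms(1) by auto
  moreover have "set (rev (map (m_inv G) ws)) \<subseteq> S \<union> m_inv G ` S"
    using ws(1) assms(1) by fastforce
  ultimately show ?thesis
    using word_length_le[of "rev (map (m_inv G) ws)" S] ws foldr_mult_inv[of ws] by simp
qed

lemma Metric_space_word_dist:
  fixes G (structure)
  assumes "group G" and S: "S \<subseteq> carrier G" and gen: "generate G S = carrier G"
  shows "Metric_space (carrier G) (word_dist G S)"
proof -
  interpret group G by fact
  have inv_eq: "word_length G S (inv g) = word_length G S g" if "g \<in> carrier G" for g
    using word_length_inv_le[OF S gen, of g] word_length_inv_le[OF S gen, of "inv g"] that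
    by simp
  show ?thesis
  proof
    show "0 \<le> word_dist G S x y" for x y by (simp add: word_dist_def)
    show "word_dist G S x y = word_dist G S y x" for x y
      using inv_eq[of "inv x \<otimes> y"] by (auto simp: word_dist_def inv_mult_group)
    show "word_dist G S x y = 0 \<longleftrightarrow> x = y" if xy: "x \<in> carrier G" "y \<in> carrier G" for x y
    proof
      assume "word_dist G S x y = 0"
      then have "word_length G S (inv x \<otimes> y) = 0" using xy by (simp add: word_dist_def)
      then have "inv x \<otimes> y = \<one>"
        using shortest_word[OF S gen, of "inv x \<otimes> y"] xy by (metis foldr_Nil id_apply inv_closed length_0_conv m_closed)
      then show "x = y" using xy by (metis inv_equality inv_inv inv_closed)
    next
      assume "x = y"
      then show "word_dist G S x y = 0"
        using word_length_le[of "[]" S] xy by (simp add: word_dist_def)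
    qed
    show "word_dist G S x z \<le> word_dist G S x y + word_dist G S y z"
      if xyz: "x \<in> carrier G" "y \<in> carrier G" "z \<in> carrier G" for x y z
    proof -
      obtain us where us: "set us \<subseteq> S \<union> m_inv G ` S" "foldr (\<otimes>) us \<one> = inv x \<otimes> y"
        "length us = word_length G S (inv x \<otimes> y)"
        using shortest_word[OF S gen, of "inv x \<otimes> y"] xyz by auto
      obtain ws where ws: "set ws \<subseteq> S \<union> m_inv G ` S" "foldr (\<otimes>) ws \<one> = inv y \<otimes> z"
        "length ws = word_length G S (inv y \<otimes> z)"
        using shortest_word[OF S gen, of "inv y \<otimes> z"] xyz by auto
      have "S \<union> m_inv G ` S \<subseteq> carrier G" using S by auto
      then have "foldr (\<otimes>) (us @ ws) \<one> = (inv x \<otimes> y) \<otimes> (inv y \<otimes> z)"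
        using us ws foldr_mult_append[of us ws] by auto
      also have "\<dots> = inv x \<otimes> z"
        using xyz by (metis inv_closed inv_solve_left m_assoc m_closed)
      finally have "word_length G S (inv x \<otimes> z) \<le> length (us @ ws)"
        using word_length_le[of "us @ ws" S] us ws by auto
      then show ?thesis using us ws xyz by (simp add: word_dist_def)
    qed
  qed
qed

text \<open>The Cayley graph is the geometric realization of the graph with vertex set \<open>carrier G\<close> and an
  edge between \<open>g\<close> and \<open>g \<otimes> s\<close> for each \<open>s \<in> S\<close>.  Points are given by barycentric coordinates:
  \<open>edge_point g h t\<close> is the point at parameter \<open>t\<close> of the edge from \<open>g\<close> to \<open>h\<close>, and
  \<open>edge_point g g t\<close> is the vertex \<open>g\<close>.  Hence parallel edges are identified and loops are
  collapsed.\<close>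

definition edge_point :: "'a \<Rightarrow> 'a \<Rightarrow> real \<Rightarrow> 'a \<Rightarrow> real" where
  "edge_point g h t = (\<lambda>v. (1 - t) * of_bool (v = g) + t * of_bool (v = h))"

definition cayley_points :: "('a, 'b) monoid_scheme \<Rightarrow> 'a set \<Rightarrow> ('a \<Rightarrow> real) set" where
  "cayley_points G S =
     {edge_point g g 0 | g. g \<in> carrier G} \<union>
     {edge_point g (g \<otimes>\<^bsub>G\<^esub> s) t | g s t. g \<in> carrier G \<and> s \<in> S \<and> t \<in> {0..1}}"

text \<open>\<open>cayley_path G S x l y\<close>: there is a piecewise linear path of length \<open>l\<close> from \<open>x\<close> to \<open>y\<close>,
  every edge having length 1.  The metric is the induced path metric.\<close>

inductive cayley_path ::
  "('a, 'b) monoid_scheme \<Rightarrow> 'a set \<Rightarrow> ('a \<Rightarrow> real) \<Rightarrow> real \<Rightarrow> ('a \<Rightarrow> real) \<Rightarrow> bool"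
  for G :: "('a, 'b) monoid_scheme" and S :: "'a set" where
  refl: "x \<in> cayley_points G S \<Longrightarrow> cayley_path G S x 0 x"
| step: "\<lbrakk>cayley_path G S x l (edge_point g (g \<otimes>\<^bsub>G\<^esub> s) t); g \<in> carrier G; s \<in> S;
          t \<in> {0..1}; t' \<in> {0..1}\<rbrakk>
         \<Longrightarrow> cayley_path G S x (l + \<bar>t' - t\<bar>) (edge_point g (g \<otimes>\<^bsub>G\<^esub> s) t')"

definition cayley_dist ::
  "('a, 'b) monoid_scheme \<Rightarrow> 'a set \<Rightarrow> ('a \<Rightarrow> real) \<Rightarrow> ('a \<Rightarrow> real) \<Rightarrow> real" where
  "cayley_dist G S x y =
     (if x \<in> cayley_points G S \<and> y \<in> cayley_points G S
      then Inf {l. cayley_path G S x l y} else 0)"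

lemma edge_point_simps: "edge_point g h 0 = edge_point g g 0" "edge_point g h 1 = edge_point h h 0"
  by (auto simp: edge_point_def)

lemma cayley_path_trans:
  assumes "cayley_path G S y m z" "cayley_path G S x l y"
  shows "cayley_path G S x (l + m) z"
  using assms
proof (induction rule: cayley_path.induct)
  case (refl y)
  then show ?case by simp
next
  case (step y m g s t t')
  then show ?case
    using cayley_path.step[of G S x "l + m" g s t t'] by (simp add: add.assoc)
qed

lemma cayley_path_edge:
  assumes "g \<in> carrier G" "s \<in> S" "t \<in> {0..1}" "t' \<in> {0..1}"
  shows "cayley_path G S (edge_point g (g \<otimes>\<^bsub>G\<^esub> s) t) \<bar>t' - t\<bar> (edge_point g (g \<otimes>\<^bsub>G\<^esub> s) t')"
proof -
  have "edge_point g (g \<otimes>\<^bsub>G\<^esub> s) t \<in> cayley_points G S"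
    using assms unfolding cayley_points_def by blast
  from cayley_path.step[OF cayley_path.refl[OF this] assms] show ?thesis by simp
qed

lemma cayley_path_sym:
  assumes "cayley_path G S x l y"
  shows "cayley_path G S y l x"
  using assms
proof (induction rule: cayley_path.induct)
  case (refl x)
  then show ?case by (rule cayley_path.refl)
next
  case (step x l g s t t')
  have "cayley_path G S (edge_point g (g \<otimes>\<^bsub>G\<^esub> s) t') \<bar>t - t'\<bar> (edge_point g (g \<otimes>\<^bsub>G\<^esub> s) t)"
    using step by (intro cayley_path_edge) auto
  from cayley_path_trans[OF step.IH this] show ?case
    by (simp add: add.commute abs_minus_commute)
qed

lemma cayley_path_lower_bound:
  assumes "cayley_path G S x l y"
  shows "\<bar>y v - x v\<bar> \<le> l"
  using assms
proof (induction rule: cayley_path.induct)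
  case (step x l g s t t')
  have "\<bar>edge_point g (g \<otimes>\<^bsub>G\<^esub> s) t' v - edge_point g (g \<otimes>\<^bsub>G\<^esub> s) t v\<bar> \<le> \<bar>t' - t\<bar>"
    by (auto simp: edge_point_def)
  with step.IH show ?case by linarith
qed auto

lemma cayley_path_vertices:
  fixes G (structure)
  assumes "group G" "S \<subseteq> carrier G" "w \<in> generate G S" "g \<in> carrier G"
  shows "\<exists>l. cayley_path G S (edge_point g g 0) l (edge_point (g \<otimes>\<^bsub>G\<^esub> w) (g \<otimes>\<^bsub>G\<^esub> w) 0)"
proof -
  interpret group G by fact
  have edge: "cayley_path G S (edge_point g g 0) 1 (edge_point (g \<otimes> s) (g \<otimes> s) 0)"
    if "s \<in> S" "g \<in> carrier G" for g s
    using cayley_path_edge[of g G s S 0 1] that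
      edge_point_simps[of g "g \<otimes> s"] by simp
  show ?thesis
    using assms(3,4)
  proof (induction arbitrary: g)
    case one
    then have "edge_point g g 0 \<in> cayley_points G S" by (auto simp: cayley_points_def)
    from cayley_path.refl[OF this] one show ?case by auto
  next
    case (incl h)
    then show ?case using edge by blast
  next
    case (inv h)
    have h: "h \<in> carrier G" using inv assms(2) by auto
    then have "g \<otimes> inv h \<otimes> h = g" using inv by (simp add: m_assoc)
    then show ?case using edge[of h "g \<otimes> inv h"] inv h cayley_path_sym by fastforce
  next
    case (eng u w)
    have c: "u \<in> carrier G" "w \<in> carrier G"
      using eng generate_in_carrier[OF assms(2)] by auto
    obtain l where "cayley_path G S (edge_point g g 0) l (edge_point (g \<otimes> u) (g \<otimes> u) 0)"
      using eng by blast
    moreover obtain m where "cayley_path G S (edge_point (g \<otimes> u) (g \<otimes> u) 0) m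
        (edge_point (g \<otimes> u \<otimes> w) (g \<otimes> u \<otimes> w) 0)"
      using eng.IH(2)[of "g \<otimes> u"] eng.prems c by auto
    ultimately show ?case
      using cayley_path_trans eng.prems c by (metis m_assoc)
  qed
qed

lemma cayley_path_exists:
  fixes G (structure)
  assumes "group G" "S \<subseteq> carrier G" "generate G S = carrier G"
    and x: "x \<in> cayley_points G S" and y: "y \<in> cayley_points G S"
  shows "\<exists>l. cayley_path G S x l y"
proof -
  interpret group G by fact
  have vertex: "\<exists>g l. g \<in> carrier G \<and> cayley_path G S (edge_point g g 0) l z"
    if "z \<in> cayley_points G S" for z
    using that unfolding cayley_points_def
  proof
    assume "z \<in> {edge_point g g 0 |g. g \<in> carrier G}"
    then show ?thesis using cayley_path.refl[OF that] by auto
  next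
    assume "z \<in> {edge_point g (g \<otimes> s) t |g s t. g \<in> carrier G \<and> s \<in> S \<and> t \<in> {0..1}}"
    then obtain g s t where z: "z = edge_point g (g \<otimes> s) t" "g \<in> carrier G" "s \<in> S" "t \<in> {0..1}"
      by blast
    then have "cayley_path G S (edge_point g g 0) \<bar>t - 0\<bar> z"
      using cayley_path_edge[of g G s S 0 t] edge_point_simps(1)[of g "g \<otimes> s"] by simp
    then show ?thesis using z by blast
  qed
  obtain g l where g: "g \<in> carrier G" "cayley_path G S (edge_point g g 0) l x"
    using vertex[OF x] by blast
  obtain h m where h: "h \<in> carrier G" "cayley_path G S (edge_point h h 0) m y"
    using vertex[OF y] by blast
  have "g \<otimes> (inv g \<otimes> h) = h" using g h by (simp add: m_assoc[symmetric])
  then obtain n where "cayley_path G S (edge_point g g 0) n (edge_point h h 0)"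
    using cayley_path_vertices[OF assms(1,2), of "inv g \<otimes> h" g] assms(3) g h by auto
  then show ?thesis using g h cayley_path_trans cayley_path_sym by metis
qed

lemma Metric_space_cayley_dist:
  assumes "group G" "S \<subseteq> carrier G" "generate G S = carrier G"
  shows "Metric_space (cayley_points G S) (cayley_dist G S)"
proof -
  let ?P = "cayley_points G S"
  let ?L = "\<lambda>x y. {l. cayley_path G S x l y}"
  have ne: "?L x y \<noteq> {}" if "x \<in> ?P" "y \<in> ?P" for x y
    using cayley_path_exists[OF assms that] by auto
  have nonneg: "0 \<le> l" if "l \<in> ?L x y" for x y l
    using cayley_path_lower_bound[of G S x l y undefined] that by simp
  have bdd: "bdd_below (?L x y)" for x y
    using nonneg by (meson bdd_below.I)
  show ?thesis
  proof
    show "0 \<le> cayley_dist G S x y" for x y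
      using ne[of x y] nonneg[of _ x y] by (auto simp: cayley_dist_def intro!: cInf_greatest)
    show "cayley_dist G S x y = cayley_dist G S y x" for x y
    proof -
      have "?L x y = ?L y x" using cayley_path_sym by blast
      then show ?thesis by (simp add: cayley_dist_def)
    qed
    show "cayley_dist G S x y = 0 \<longleftrightarrow> x = y" if xy: "x \<in> ?P" "y \<in> ?P" for x y
    proof
      assume "cayley_dist G S x y = 0"
      then have z: "Inf (?L x y) = 0" using xy by (simp add: cayley_dist_def)
      have "\<bar>y v - x v\<bar> \<le> Inf (?L x y)" for v
        using ne[OF xy] cayley_path_lower_bound by (intro cInf_greatest) auto
      then show "x = y" using z by (intro ext) auto
    next
      assume "x = y"
      then have "0 \<in> ?L x y" using cayley_path.refl xy by blast
      then have "Inf (?L x y) = 0"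
        using nonneg[of _ x y] by (intro cInf_eq_minimum) auto
      then show "cayley_dist G S x y = 0" by (simp add: cayley_dist_def)
    qed
    show "cayley_dist G S x z \<le> cayley_dist G S x y + cayley_dist G S y z"
      if xyz: "x \<in> ?P" "y \<in> ?P" "z \<in> ?P" for x y z
    proof -
      have le: "Inf (?L x z) \<le> l + m" if "l \<in> ?L x y" "m \<in> ?L y z" for l m
        using cInf_lower[OF _ bdd] cayley_path_trans that by blast
      have "Inf (?L x z) - m \<le> Inf (?L x y)" if "m \<in> ?L y z" for m
        using le[OF _ that] ne[OF xyz(1,2)] by (intro cInf_greatest) force+
      then have "Inf (?L x z) - Inf (?L x y) \<le> Inf (?L y z)"
        using ne[OF xyz(2,3)] by (intro cInf_greatest) force+
      then show ?thesis using xyz by (simp add: cayley_dist_def)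
    qed
  qed
qed

definition cayley_graph :: "('a, 'b) monoid_scheme \<Rightarrow> 'a set \<Rightarrow> ('a \<Rightarrow> real) topology" where
  "cayley_graph G S = Metric_space.mtopology (cayley_points G S) (cayley_dist G S)"

definition ends_of_group :: "('a, 'b) monoid_scheme \<Rightarrow> 'a set \<Rightarrow> (real \<Rightarrow> 'a \<Rightarrow> real) set set" where
  "ends_of_group G S = ends_of_space (cayley_graph G S)"

end

theory Submission
  imports Defs
begin

text \<open>
  Both sides are compared with a combinatorial condition: \<open>G\<close> is infinite and every subset of
  \<open>G\<close> with finite boundary is finite or cofinite.  A subset with finite boundary has a Higson
  indicator function, so if it is infinite and coinfinite it disconnects the corona; it also
  separates two proper rays of the Cayley graph, which exist by Koenig's lemma.  Conversely, the traces
  on \<open>G\<close> of a separation of the corona, or of a path component of the complement of a compact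
  subset of the Cayley graph, have finite boundary.

  For decomposability, take a bi-infinite geodesic with halves \<open>g\<close> and \<open>h\<close> and let
  \<open>A\<close> be the cone of points \<open>x\<close> with \<open>d x (h k) \<le> k / 2\<close> for some
  \<open>k\<close>.  The cone is connected at infinity, so its trace on the corona is a subcontinuum.  This
  trace misses the limit points of \<open>g\<close> and is a neighbourhood of those of \<open>h\<close>, because
  distances to \<open>A\<close> and to its complement, divided by the distance to the origin, are Higson
  functions.  A continuum with a proper subcontinuum of nonempty interior is decomposable.
\<close>

section \<open>Decomposable continua\<close>

text \<open>Open sets in the corona are certified by separation that grows linearly with the
  distance to a base point \<open>v\<close>: dividing a distance function by \<open>d v x\<close>
  makes it slowly varying, and only linear growth survives this division. Hence \<open>A\<close> is
  a cone of linear width and not a tube of bounded width around \<open>h\<close>. A half-line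
  satisfies the combinatorial condition too, but there the cone around the only direction is the
  whole space. Homogeneity of the group removes this obstacle: it moves midpoints of long geodesics
  to \<open>v\<close> and so yields a line, along which \<open>d (g m) (h k) \<ge> m + k\<close>.
  The slope 1/2 leaves room on both sides. Points within \<open>k / 2\<close> of \<open>h k\<close>
  still have distance at least \<open>k / 2\<close> from \<open>v\<close>, so paths inside the cone
  stay far out; points outside the cone are farther than \<open>k / 2\<close> from
  \<open>h k\<close>, so the cone contains a neighbourhood of the limit points of
  \<open>h\<close>.\<close>

lemma decomposable_if_proper_subcontinuum:
  assumes X: "continuum X"
    and C: "closedin X C" "connectedin X C" "C \<noteq> topspace X"
    and U: "openin X U" "U \<subseteq> C" "U \<noteq> {}"
  shows "decomposable X"
proof -
  have CX: "C \<subseteq> topspace X" "C \<noteq> {}"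
    using C U closedin_subset by auto
  have sub: "continuum (subtopology X D)" if "closedin X D" "connectedin X D" "D \<noteq> {}" for D
  proof -
    have "compactin X D"
      using X that(1) closedin_compact_space unfolding continuum_def by blast
    moreover have "D \<subseteq> topspace X"
      using that(1) closedin_subset by blast
    ultimately show ?thesis
      using X that unfolding continuum_def
      by (auto simp: compact_space_subtopology connectedin_def Hausdorff_space_subtopology Int_absorb1)
  qed
  define W where "W = topspace X - C"
  have W: "openin X W" "W \<noteq> {}"
    using C CX unfolding W_def by auto
  show ?thesis
  proof (cases "connectedin X W")
    case True
    \<comment> \<open>If the complement of \<open>C\<close> is connected, its closure is the second
      subcontinuum. It misses the open set \<open>U\<close>, hence is proper.\<close>
    let ?D = "X closure_of W"
    have WD: "W \<subseteq> ?D"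
      using W by (simp add: closure_of_subset openin_subset)
    have "U \<inter> ?D = {}"
      using U openin_Int_closure_of_eq_empty[of X U W] unfolding W_def by blast
    moreover have "?D \<subseteq> topspace X"
      by (rule closure_of_subset_topspace)
    moreover have "U \<subseteq> topspace X"
      using U openin_subset by blast
    ultimately have "?D \<subset> topspace X"
      using U by blast
    moreover have "continuum (subtopology X ?D)"
      using sub[of ?D] WD W True connectedin_closure_of by auto
    moreover have "C \<union> ?D = topspace X"
      using WD CX closure_of_subset_topspace[of X W] unfolding W_def by blast
    moreover have "continuum (subtopology X C)"
      using sub C CX by blast
    ultimately show ?thesis
      using C CX unfolding decomposable_def by blast
  next
    case False
    then obtain E1 E2 where E: "openin X E1" "openin X E2" "W \<subseteq> E1 \<union> E2" "E1 \<inter> E2 \<inter> W = {}"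
      "E1 \<inter> W \<noteq> {}" "E2 \<inter> W \<noteq> {}"
      using W openin_subset unfolding connectedin by metis
    \<comment> \<open>If the complement splits into open pieces \<open>V\<close> and
      \<open>V'\<close>, gluing either piece to \<open>C\<close> gives a continuum, and the other
      piece witnesses that it is proper.\<close>
    have absorb: "closedin X (C \<union> V)" "connectedin X (C \<union> V)"
      if V: "openin X V" "openin X V'" "V \<union> V' = W" "V \<inter> V' = {}" for V V'
    proof -
      have eq: "C \<union> V = topspace X - V'"
        using V CX unfolding W_def by blast
      show cl: "closedin X (C \<union> V)"
        using V by (simp add: eq closedin_diff)
      \<comment> \<open>Connectedness of \<open>C\<close> puts it on one side of a separation of
        \<open>C \<union> V\<close>. The other side is closed, and it is open because it equals
        \<open>V - F1\<close>; a nonempty clopen set in a connected space is everything.\<close>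
      have no: False
        if F: "closedin X F1" "closedin X F2" "C \<union> V \<subseteq> F1 \<union> F2" "F1 \<inter> F2 \<inter> (C \<union> V) = {}"
          "F2 \<inter> (C \<union> V) \<noteq> {}" "C \<inter> F2 = {}" for F1 F2
      proof -
        let ?T = "F2 \<inter> (C \<union> V)"
        have "?T = V - F1"
          using F by blast
        then have "openin X ?T"
          using V F by (simp add: openin_diff)
        moreover have "closedin X ?T"
          using F cl by blast
        ultimately have "?T = topspace X"
          using X F unfolding continuum_def connected_space_clopen_in by blast
        then show False
          using F CX by blast
      qed
      show "connectedin X (C \<union> V)"
        unfolding connectedin_closedin
      proof (intro conjI notI)
        show "C \<union> V \<subseteq> topspace X"
          using cl closedin_subset by blast
      next
        assume "\<exists>F1 F2. closedin X F1 \<and> closedin X F2 \<and> C \<union> V \<subseteq> F1 \<union> F2 \<and>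
          F1 \<inter> F2 \<inter> (C \<union> V) = {} \<and> F1 \<inter> (C \<union> V) \<noteq> {} \<and> F2 \<inter> (C \<union> V) \<noteq> {}"
        then obtain F1 F2 where F: "closedin X F1" "closedin X F2" "C \<union> V \<subseteq> F1 \<union> F2"
          "F1 \<inter> F2 \<inter> (C \<union> V) = {}" "F1 \<inter> (C \<union> V) \<noteq> {}" "F2 \<inter> (C \<union> V) \<noteq> {}"
          by blast
        have "\<not> (F1 \<inter> C \<noteq> {} \<and> F2 \<inter> C \<noteq> {})"
          using C(2) F(1-4) unfolding connectedin_closedin by blast
        then show False
          using no[of F1 F2] no[of F2 F1] F by blast
      qed
    qed
    let ?V1 = "E1 \<inter> W" and ?V2 = "E2 \<inter> W"
    have V: "openin X ?V1" "openin X ?V2" "?V1 \<union> ?V2 = W" "?V1 \<inter> ?V2 = {}" "?V2 \<union> ?V1 = W" "?V2 \<inter> ?V1 = {}"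
      using E W by auto
    have "continuum (subtopology X (C \<union> ?V1))" "continuum (subtopology X (C \<union> ?V2))"
      using absorb[OF V(1,2,3,4)] absorb[OF V(2,1,5,6)] sub CX by auto
    moreover have CW: "C \<union> W = topspace X" "C \<inter> W = {}"
      using CX unfolding W_def by auto
    moreover have psub: "C \<union> V \<subset> topspace X" if "V \<subseteq> W" "V' \<subseteq> W" "V \<inter> V' = {}" "V' \<noteq> {}" for V V'
      using CW that by blast
    moreover have "(C \<union> ?V1) \<union> (C \<union> ?V2) = topspace X"
      using V(3) CW by blast
    ultimately show ?thesis
      using psub[of ?V1 ?V2] psub[of ?V2 ?V1] V(4,6) E(5,6) unfolding decomposable_def by blast
  qed
qed

section \<open>The Higson corona of a graph\<close>

text \<open>The vertex set of a connected locally finite graph with the path metric.\<close>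

locale proper_graph_space = Metric_space +
  assumes dist_Nats: "x \<in> M \<Longrightarrow> y \<in> M \<Longrightarrow> d x y \<in> \<nat>"
    and dist_step: "x \<in> M \<Longrightarrow> y \<in> M \<Longrightarrow> x \<noteq> y \<Longrightarrow> \<exists>z\<in>M. d x z = 1 \<and> d z y = d x y - 1"
    and finite_mcball: "x \<in> M \<Longrightarrow> finite (mcball x r)"
begin

section \<open>Higson functions on a discrete space\<close>

lemma mtopology_discrete: "mtopology = discrete_topology M"
proof -
  have "openin mtopology U" if "U \<subseteq> M" for U
    unfolding openin_mtopology
  proof (intro conjI allI impI that)
    fix x assume x: "x \<in> U"
    have "mball x 1 \<subseteq> U"
    proof
      fix y assume y: "y \<in> mball x 1"
      then obtain n where "d x y = real n"
        using dist_Nats by (metis Nats_cases in_mball)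
      then show "y \<in> U"
        using y x by auto
    qed
    then show "\<exists>r>0. mball x r \<subseteq> U"
      using zero_less_one by blast
  qed
  then show ?thesis
    unfolding topology_eq by (metis openin_discrete_topology openin_subset topspace_mtopology)
qed

text \<open>Compact sets are finite here, so the Higson condition becomes a finiteness statement
  about points that see an oscillation of size \<open>\<epsilon>\<close> within distance
  \<open>r\<close>.\<close>

lemma higson_functionsI:
  assumes "f \<in> extensional M" "bounded (f ` M)"
    and fin: "\<And>r \<epsilon>. r > 0 \<Longrightarrow> \<epsilon> > 0 \<Longrightarrow> finite {x \<in> M. \<exists>y\<in>M. d x y \<le> r \<and> \<epsilon> \<le> \<bar>f x - f y\<bar>}"
  shows "f \<in> higson_functions"
proof -
  have "\<exists>K. compactin mtopology K \<and> (\<forall>x\<in>M - K. diameter (f ` mcball x r) < \<epsilon>)"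
    if "r > 0" "\<epsilon> > 0" for r \<epsilon> :: real
  proof (intro exI conjI ballI)
    \<comment> \<open>Comparing two values through \<open>f x\<close> doubles
      \<open>\<epsilon> / 4\<close>; the remaining factor 2 turns the weak bound on the supremum
      into a strict one.\<close>
    let ?K = "{x \<in> M. \<exists>y\<in>M. d x y \<le> r \<and> \<epsilon> / 4 \<le> \<bar>f x - f y\<bar>}"
    show "compactin mtopology ?K"
      using fin[of r "\<epsilon> / 4"] that by (simp add: mtopology_discrete compactin_discrete_topology)
    fix x assume x: "x \<in> M - ?K"
    have near: "\<bar>f x - f y\<bar> < \<epsilon> / 4" if "y \<in> mcball x r" for y
      using x that by force
    have "norm (a - b) \<le> \<epsilon> / 2" if ab: "a \<in> f ` mcball x r" "b \<in> f ` mcball x r" for a b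
    proof -
      obtain y z where yz: "a = f y" "b = f z" "y \<in> mcball x r" "z \<in> mcball x r"
        using ab by blast
      have "\<bar>f x - f y\<bar> < \<epsilon> / 4" "\<bar>f x - f z\<bar> < \<epsilon> / 4"
        using near yz by blast+
      then show ?thesis
        unfolding yz real_norm_def by linarith
    qed
    then have "diameter (f ` mcball x r) \<le> \<epsilon> / 2"
      using that by (intro diameter_le) auto
    then show "diameter (f ` mcball x r) < \<epsilon>"
      using that by simp
  qed
  then show ?thesis
    using assms(1,2) by (simp add: higson_functions_def mtopology_discrete)
qed

lemma higson_functionsD:
  assumes f: "f \<in> higson_functions" and "r > 0" "\<epsilon> > 0"
  shows "finite {x \<in> M. \<exists>y\<in>M. d x y \<le> r \<and> \<epsilon> \<le> \<bar>f x - f y\<bar>}"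
proof -
  obtain K where K: "compactin mtopology K" "\<forall>x\<in>M - K. diameter (f ` mcball x r) < \<epsilon>"
    using assms unfolding higson_functions_def by blast
  have "{x \<in> M. \<exists>y\<in>M. d x y \<le> r \<and> \<epsilon> \<le> \<bar>f x - f y\<bar>} \<subseteq> K"
  proof clarsimp
    fix x y assume xy: "x \<in> M" "y \<in> M" "d x y \<le> r" "\<epsilon> \<le> \<bar>f x - f y\<bar>"
    show "x \<in> K"
    proof (rule ccontr)
      assume "x \<notin> K"
      then have "diameter (f ` mcball x r) < \<epsilon>"
        using K xy by auto
      moreover have "bounded (f ` mcball x r)"
        using f by (auto simp: higson_functions_def intro: bounded_subset)
      then have "dist (f x) (f y) \<le> diameter (f ` mcball x r)"
        using xy assms by (intro diameter_bounded_bound) auto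
      ultimately show False
        using xy by (simp add: dist_real_def)
    qed
  qed
  then show ?thesis
    using K(1) finite_subset by (auto simp: mtopology_discrete compactin_discrete_topology)
qed

text \<open>A geodesic between points on different sides of \<open>A\<close> crosses the boundary,
  so every point that sees an oscillation within distance \<open>r\<close> lies within
  \<open>r\<close> of the finite boundary.\<close>

lemma indicator_higson:
  assumes A: "A \<subseteq> M" and fin: "finite {x \<in> A. \<exists>y\<in>M - A. d x y \<le> 1}"
  shows "(\<lambda>x\<in>M. of_bool (x \<in> A)) \<in> higson_functions"
proof (rule higson_functionsI)
  let ?f = "\<lambda>x\<in>M. of_bool (x \<in> A) :: real"
  let ?B = "{x \<in> A. \<exists>y\<in>M - A. d x y \<le> 1}"
  show "?f \<in> extensional M" by simp
  show "bounded (?f ` M)"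
    by (rule bounded_subset[of "{0..1}"]) auto
  fix r \<epsilon> :: real assume "r > 0" "\<epsilon> > 0"
  \<comment> \<open>Induction along a geodesic: move on while the next vertex stays in
    \<open>A\<close>; when it leaves, the current vertex is the boundary point.\<close>
  have cross: "\<exists>b\<in>?B. d x b \<le> real n \<and> d b y \<le> real n"
    if "x \<in> A" "y \<in> M - A" "d x y = real n" for x y n
    using that
  proof (induction n arbitrary: x)
    case 0
    then show ?case using A by auto
  next
    case (Suc n)
    then obtain z where z: "z \<in> M" "d x z = 1" "d z y = real n"
      using dist_step[of x y] A by auto
    show ?case
    proof (cases "z \<in> A")
      case True
      then obtain b where b: "b \<in> ?B" "d z b \<le> real n" "d b y \<le> real n"
        using Suc.IH[of z] Suc.prems z by blast
      have "d x b \<le> d x z + d z b"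
        using b z A Suc.prems by (intro triangle) auto
      then have "d x b \<le> real (Suc n)" "d b y \<le> real (Suc n)"
        using b z by auto
      then show ?thesis using b by blast
    next
      case False
      then have "z \<in> M - A" "d x z \<le> 1"
        using z by auto
      then have "x \<in> ?B"
        using Suc.prems by blast
      moreover have "d x x = 0" using Suc.prems A by auto
      ultimately show ?thesis using Suc.prems
        by (intro bexI[of _ x]) auto
    qed
  qed
  have "{x \<in> M. \<exists>y\<in>M. d x y \<le> r \<and> \<epsilon> \<le> \<bar>?f x - ?f y\<bar>} \<subseteq> (\<Union>b\<in>?B. mcball b r)"
  proof clarify
    fix x y assume xy: "x \<in> M" "y \<in> M" "d x y \<le> r" "\<epsilon> \<le> \<bar>?f x - ?f y\<bar>"
    obtain n where n: "d x y = real n"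
      using dist_Nats xy by (metis Nats_cases)
    have ne: "(x \<in> A) \<noteq> (y \<in> A)"
      using xy \<open>\<epsilon> > 0\<close> by (cases "x \<in> A"; cases "y \<in> A") auto
    obtain b where b: "b \<in> ?B" "d b x \<le> real n"
    proof (cases "x \<in> A")
      case True
      then have "\<exists>b\<in>?B. d x b \<le> real n \<and> d b y \<le> real n"
        using ne xy n by (intro cross) auto
      then show ?thesis using that commute[of x] by auto
    next
      case False
      then have "\<exists>b\<in>?B. d y b \<le> real n \<and> d b x \<le> real n"
        using ne xy n commute[of x y] by (intro cross) auto
      then show ?thesis using that by auto
    qed
    then show "x \<in> (\<Union>b\<in>?B. mcball b r)"
      using n xy A by auto
  qed
  moreover have "finite (\<Union>b\<in>?B. mcball b r)"
    using fin A finite_mcball by auto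
  ultimately show "finite {x \<in> M. \<exists>y\<in>M. d x y \<le> r \<and> \<epsilon> \<le> \<bar>?f x - ?f y\<bar>}"
    by (rule finite_subset)
qed

section \<open>The compactification in coordinates\<close>

lemma topspace_higson_product:
  "topspace higson_product = (\<Pi>\<^sub>E f\<in>higson_functions. {Inf (f ` M)..Sup (f ` M)})"
  by (simp add: higson_product_def)

lemma compact_space_higson_product: "compact_space higson_product"
  unfolding higson_product_def compact_space_product_topology
  by (simp add: compact_space_subtopology)

lemma Hausdorff_space_higson_product: "Hausdorff_space higson_product"
  unfolding higson_product_def Hausdorff_space_product_topology
  by (simp add: Hausdorff_space_subtopology)

lemma continuous_map_higson_coordinate:
  assumes "f \<in> higson_functions"
  shows "continuous_map higson_product euclideanreal (\<lambda>\<phi>. \<phi> f)"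
  using continuous_map_product_coordinates[OF assms, of "\<lambda>f. top_of_set {Inf (f ` M)..Sup (f ` M)}"]
  unfolding higson_product_def continuous_map_in_subtopology by simp

lemma higson_evaluation_in:
  assumes "x \<in> M"
  shows "higson_evaluation x \<in> topspace higson_product"
proof -
  have "f x \<in> {Inf (f ` M)..Sup (f ` M)}" if "f \<in> higson_functions" for f
  proof -
    have "bounded (f ` M)"
      using that by (simp add: higson_functions_def)
    then show ?thesis
      using assms by (auto intro!: cInf_lower cSup_upper bounded_imp_bdd_below bounded_imp_bdd_above)
  qed
  then show ?thesis
    by (auto simp: topspace_higson_product higson_evaluation_def)
qed

text \<open>Basic neighbourhoods in the product restrict only finitely many coordinates, so the
  closure is described by approximating finitely many Higson functions at one common point of
  \<open>A\<close>.\<close>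

lemma higson_closure_iff:
  assumes A: "A \<subseteq> M"
  shows "\<phi> \<in> higson_product closure_of (higson_evaluation ` A) \<longleftrightarrow>
    \<phi> \<in> topspace higson_product \<and>
    (\<forall>F \<epsilon>. finite F \<and> F \<subseteq> higson_functions \<and> \<epsilon> > 0 \<longrightarrow> (\<exists>x\<in>A. \<forall>f\<in>F. \<bar>f x - \<phi> f\<bar> < \<epsilon>))"
    (is "?l \<longleftrightarrow> ?t \<and> ?r")
proof
  assume l: ?l
  then have t: ?t
    by (simp add: in_closure_of)
  have ?r
  proof (intro allI impI)
    fix F and \<epsilon> :: real
    assume F: "finite F \<and> F \<subseteq> higson_functions \<and> \<epsilon> > 0"
    let ?X = "\<lambda>f. top_of_set {Inf (f ` M)..Sup (f ` M)}"
    define U where "U f = (if f \<in> F then topspace (?X f) \<inter> ball (\<phi> f) \<epsilon> else topspace (?X f))" for f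
    have "openin higson_product (\<Pi>\<^sub>E f\<in>higson_functions. U f)"
      unfolding higson_product_def
    proof (rule product_topology_basis)
      show "openin (?X f) (U f)" for f
        unfolding U_def by (auto simp: openin_open_Int)
      show "finite {f. U f \<noteq> topspace (?X f)}"
        using F by (auto simp: U_def intro: finite_subset[of _ F])
    qed
    moreover have "\<phi> \<in> (\<Pi>\<^sub>E f\<in>higson_functions. U f)"
      using t F by (auto simp: U_def topspace_higson_product PiE_iff)
    ultimately obtain x where "x \<in> A" "higson_evaluation x \<in> (\<Pi>\<^sub>E f\<in>higson_functions. U f)"
      using l by (auto simp: in_closure_of)
    moreover have "\<bar>f x - \<phi> f\<bar> < \<epsilon>"
      if "higson_evaluation x \<in> (\<Pi>\<^sub>E f\<in>higson_functions. U f)" "f \<in> F" for f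
    proof -
      have "f \<in> higson_functions" using F that by blast
      then have "f x \<in> U f"
        using PiE_mem[OF that(1)] by (simp add: higson_evaluation_def)
      then show ?thesis
        using that by (simp add: U_def dist_real_def abs_minus_commute)
    qed
    ultimately show "\<exists>x\<in>A. \<forall>f\<in>F. \<bar>f x - \<phi> f\<bar> < \<epsilon>"
      by blast
  qed
  with t show "?t \<and> ?r" by blast
next
  assume r: "?t \<and> ?r"
  show ?l
    unfolding in_closure_of
  proof (intro conjI allI impI)
    show ?t using r by blast
    fix T assume T: "\<phi> \<in> T \<and> openin higson_product T"
    let ?X = "\<lambda>f. top_of_set {Inf (f ` M)..Sup (f ` M)}"
    obtain U where U: "finite {f \<in> higson_functions. U f \<noteq> topspace (?X f)}"
      "\<And>f. f \<in> higson_functions \<Longrightarrow> openin (?X f) (U f)"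
      "\<phi> \<in> Pi\<^sub>E higson_functions U" "Pi\<^sub>E higson_functions U \<subseteq> T"
    proof -
      have "openin (product_topology ?X higson_functions) T" "\<phi> \<in> T"
        using T unfolding higson_product_def by auto
      from this(1)[unfolded openin_product_topology_alt, rule_format, OF this(2)] show ?thesis
        using that by blast
    qed
    define F where "F = {f \<in> higson_functions. U f \<noteq> topspace (?X f)}"
    have "\<exists>e>0. ball (\<phi> f) e \<inter> topspace (?X f) \<subseteq> U f" if "f \<in> F" for f
    proof -
      have f: "f \<in> higson_functions" using that F_def by blast
      then have "\<phi> f \<in> U f" using U(3) by (auto simp: PiE_iff)
      then show ?thesis using U(2)[OF f] by (auto simp: openin_contains_ball)
    qed
    then obtain e where e: "\<And>f. f \<in> F \<Longrightarrow> e f > 0 \<and> ball (\<phi> f) (e f) \<inter> topspace (?X f) \<subseteq> U f"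
      by metis
    \<comment> \<open>The extra 1 gives the minimum a meaning when no coordinate is
      restricted.\<close>
    define \<epsilon> where "\<epsilon> = Min (insert 1 (e ` F))"
    have fF: "finite F" using U(1) by (simp add: F_def)
    have \<epsilon>: "\<epsilon> > 0" "\<And>f. f \<in> F \<Longrightarrow> \<epsilon> \<le> e f"
      using e fF by (auto simp: \<epsilon>_def)
    obtain x where x: "x \<in> A" "\<And>f. f \<in> F \<Longrightarrow> \<bar>f x - \<phi> f\<bar> < \<epsilon>"
    proof -
      have "F \<subseteq> higson_functions" by (auto simp: F_def)
      then show ?thesis
        using r[THEN conjunct2, rule_format, of F \<epsilon>] fF \<epsilon>(1) that by blast
    qed
    have top: "f x \<in> topspace (?X f)" if "f \<in> higson_functions" for f
      using higson_evaluation_in[of x] x A that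
      by (auto simp: topspace_higson_product higson_evaluation_def PiE_iff)
    have "f x \<in> U f" if f: "f \<in> higson_functions" for f
    proof (cases "f \<in> F")
      case True
      then have "f x \<in> ball (\<phi> f) (e f)"
        using x(2)[OF True] \<epsilon>(2)[OF True] by (simp add: dist_real_def abs_minus_commute)
      then show ?thesis
        using e[OF True] top[OF f] by blast
    next
      case False
      then show ?thesis using top[OF f] f by (simp add: F_def)
    qed
    then have "higson_evaluation x \<in> Pi\<^sub>E higson_functions U"
      by (simp add: higson_evaluation_def)
    then show "\<exists>y. y \<in> higson_evaluation ` A \<and> y \<in> T"
      using U(4) x(1) by blast
  qed
qed

section \<open>Traces at infinity of subsets of the space\<close>

definition corona_set :: "'a set \<Rightarrow> (('a \<Rightarrow> real) \<Rightarrow> real) set" where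
  "corona_set A = higson_product closure_of (higson_evaluation ` A) - higson_evaluation ` M"

lemma higson_corona_eq: "higson_corona = subtopology higson_product (corona_set M)"
proof -
  have "topspace higson_compactification = higson_product closure_of (higson_evaluation ` M)"
    unfolding higson_compactification_def using closure_of_subset_topspace by fastforce
  then show ?thesis
    unfolding higson_corona_def higson_compactification_def corona_set_def
    by (simp add: subtopology_subtopology Int_absorb1)
qed

lemma corona_set_subset: "corona_set A \<subseteq> topspace higson_product"
  unfolding corona_set_def using closure_of_subset_topspace by fastforce

lemma corona_set_mono: "A \<subseteq> B \<Longrightarrow> corona_set A \<subseteq> corona_set B"
  unfolding corona_set_def using closure_of_mono[of "higson_evaluation ` A" "higson_evaluation ` B"]
  by blast

lemma corona_set_Un: "corona_set (A \<union> B) = corona_set A \<union> corona_set B"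
  unfolding corona_set_def image_Un closure_of_Un by blast

lemma corona_set_finite:
  assumes "finite A" "A \<subseteq> M"
  shows "corona_set A = {}"
proof -
  have "closedin higson_product (higson_evaluation ` A)"
    using assms higson_evaluation_in
    by (intro closedin_Hausdorff_finite Hausdorff_space_higson_product) auto
  then show ?thesis
    using assms by (auto simp: corona_set_def closure_of_closedin)
qed

lemma corona_set_diff_finite:
  assumes "A \<subseteq> M" "finite K"
  shows "corona_set (A - K) = corona_set A"
proof -
  have "corona_set A = corona_set ((A - K) \<union> (A \<inter> K))"
    by (rule arg_cong[where f = corona_set]) blast
  also have "\<dots> = corona_set (A - K)"
    using assms corona_set_finite[of "A \<inter> K"] by (simp add: corona_set_Un le_infI1)
  finally show ?thesis ..
qed

lemma corona_set_approx:
  assumes "\<phi> \<in> corona_set A" "A \<subseteq> M" "finite F" "F \<subseteq> higson_functions" "\<epsilon> > 0"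
  shows "\<exists>x\<in>A. \<forall>f\<in>F. \<bar>f x - \<phi> f\<bar> < \<epsilon>"
  using assms higson_closure_iff[OF assms(2), of \<phi>] unfolding corona_set_def by auto

text \<open>Finite sets leave no trace, so the exceptional points can be deleted; a closed condition
  on the remaining values of \<open>f\<close> passes to limits. Coordinates of corona points are
  computed in this way throughout.\<close>

lemma corona_set_value:
  assumes \<phi>: "\<phi> \<in> corona_set A" and A: "A \<subseteq> M" and f: "f \<in> higson_functions"
    and C: "closed C" and fin: "finite {x \<in> A. f x \<notin> C}"
  shows "\<phi> f \<in> C"
proof (rule ccontr)
  assume "\<phi> f \<notin> C"
  then obtain \<epsilon> where \<epsilon>: "\<epsilon> > 0" "ball (\<phi> f) \<epsilon> \<subseteq> - C"
    using C open_contains_ball[of "- C"] by (metis ComplI open_Compl)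
  have "\<phi> \<in> corona_set (A - {x \<in> A. f x \<notin> C})"
    using \<phi> corona_set_diff_finite[OF A fin] by simp
  then obtain x where "x \<in> A" "f x \<in> C" "\<bar>f x - \<phi> f\<bar> < \<epsilon>"
    using corona_set_approx[of \<phi> "A - {x \<in> A. f x \<notin> C}" "{f}" \<epsilon>] A f \<epsilon>(1) by auto
  then show False
    using \<epsilon>(2) by (auto simp: dist_real_def abs_minus_commute subset_iff)
qed

text \<open>Point indicators are the coordinates that tell points of \<open>M\<close> apart from
  each other and from the corona.\<close>

lemma delta_higson:
  assumes "a \<in> M"
  shows "(\<lambda>x\<in>M. of_bool (x \<in> {a})) \<in> higson_functions"
  using assms by (intro indicator_higson) auto

text \<open>Each point of \<open>M\<close> is isolated in the compactification: the coordinate of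
  its point indicator is 1 there and 0 on the corona, so cutting at 1/2 removes the points of
  \<open>M\<close> by closed conditions.\<close>

lemma closedin_corona_set:
  assumes A: "A \<subseteq> M"
  shows "closedin higson_product (corona_set A)"
proof -
  let ?\<delta> = "\<lambda>a. \<lambda>x\<in>M. of_bool (x \<in> {a}) :: real"
  let ?C = "\<lambda>a. {\<phi> \<in> topspace higson_product. \<phi> (?\<delta> a) \<in> {..1/2}}"
  have "corona_set A = \<Inter> (insert (higson_product closure_of (higson_evaluation ` A)) (?C ` M))"
  proof
    have "\<phi> (?\<delta> a) \<in> {..1/2}" if "\<phi> \<in> corona_set A" "a \<in> M" for \<phi> a
    proof (rule corona_set_value[OF that(1) A delta_higson[OF that(2)]])
      show "finite {x \<in> A. ?\<delta> a x \<notin> {..1/2}}"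
        using A by (auto intro!: finite_subset[of _ "{a}"])
    qed auto
    then show "corona_set A \<subseteq> \<Inter> (insert (higson_product closure_of (higson_evaluation ` A)) (?C ` M))"
      using corona_set_subset[of A] unfolding corona_set_def by blast
    have "higson_evaluation a \<notin> ?C a" if "a \<in> M" for a
      using delta_higson[OF that] that by (simp add: higson_evaluation_def)
    then show "\<Inter> (insert (higson_product closure_of (higson_evaluation ` A)) (?C ` M)) \<subseteq> corona_set A"
      unfolding corona_set_def by blast
  qed
  moreover have "closedin higson_product (?C a)" if "a \<in> M" for a
    by (rule closedin_continuous_map_preimage[OF continuous_map_higson_coordinate[OF delta_higson[OF that]]]) simp
  then have "closedin higson_product (\<Inter> (insert (higson_product closure_of (higson_evaluation ` A)) (?C ` M)))"
    by (intro closedin_Inter) auto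
  ultimately show ?thesis by simp
qed

text \<open>An infinite set accumulates somewhere in the compact product, and it cannot accumulate
  at a point of \<open>M\<close> because a point indicator isolates that point. Injectivity of the
  evaluation keeps the image of \<open>A\<close> infinite.\<close>

lemma corona_set_nonempty:
  assumes A: "A \<subseteq> M" "infinite A"
  shows "corona_set A \<noteq> {}"
proof -
  have sep: "x = y" if "x \<in> M" "y \<in> M"
    "\<bar>higson_evaluation x (\<lambda>z\<in>M. of_bool (z \<in> {y})) - 1\<bar> < 1" for x y
    using delta_higson[OF that(2)] that by (auto simp: higson_evaluation_def split: if_splits)
  have "inj_on higson_evaluation M"
  proof (rule inj_onI)
    fix x y assume xy: "x \<in> M" "y \<in> M" "higson_evaluation x = higson_evaluation y"
    have "higson_evaluation y (\<lambda>z\<in>M. of_bool (z \<in> {y})) = 1"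
      using delta_higson[OF xy(2)] xy(2) by (simp add: higson_evaluation_def)
    then show "x = y"
      by (intro sep xy) (simp add: xy(3))
  qed
  then have "infinite (higson_evaluation ` A)"
    using A finite_imageD inj_on_subset by blast
  then obtain p where p: "p \<in> higson_product derived_set_of (higson_evaluation ` A)"
    using compact_space_imp_Bolzano_Weierstrass[OF compact_space_higson_product, of "higson_evaluation ` A"]
      higson_evaluation_in A by blast
  have "p \<noteq> higson_evaluation y" if y: "y \<in> M" for y
  proof
    assume py: "p = higson_evaluation y"
    let ?\<delta> = "\<lambda>x\<in>M. of_bool (x \<in> {y}) :: real"
    let ?T = "{\<phi> \<in> topspace higson_product. \<phi> ?\<delta> \<in> ball 1 1}"
    have "openin higson_product ?T"
      by (rule openin_continuous_map_preimage[OF continuous_map_higson_coordinate[OF delta_higson[OF y]]]) simp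
    moreover have "p \<in> ?T"
      using delta_higson[OF y] y higson_evaluation_in[OF y] by (simp add: higson_evaluation_def py)
    ultimately have "\<exists>q. q \<noteq> p \<and> q \<in> higson_evaluation ` A \<and> q \<in> ?T"
      using p[unfolded in_derived_set_of, THEN conjunct2, rule_format, of ?T] by simp
    then obtain x where x: "x \<in> A" "higson_evaluation x \<noteq> p" "higson_evaluation x ?\<delta> \<in> ball 1 1"
      by blast
    then have "x = y"
      using A y by (intro sep) (auto simp: dist_real_def abs_minus_commute)
    then show False
      using x py by simp
  qed
  moreover have "p \<in> higson_product closure_of (higson_evaluation ` A)"
    using p by (simp add: closure_of in_derived_set_of)
  ultimately show ?thesis
    unfolding corona_set_def by blast
qed

text \<open>Outside a finite set, a Higson function hardly changes under displacements of bounded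
  length, so displaced points have the same limits.\<close>

lemma corona_set_shift:
  assumes D: "D \<subseteq> M" and \<tau>: "\<And>x. x \<in> D \<Longrightarrow> \<tau> x \<in> M \<and> d x (\<tau> x) \<le> r"
  shows "corona_set D \<subseteq> corona_set (\<tau> ` D)"
proof
  fix \<phi> assume \<phi>: "\<phi> \<in> corona_set D"
  have "\<exists>x\<in>\<tau> ` D. \<forall>f\<in>F. \<bar>f x - \<phi> f\<bar> < \<epsilon>"
    if F: "finite F" "F \<subseteq> higson_functions" "\<epsilon> > 0" for F \<epsilon>
  proof -
    \<comment> \<open>The maximum with 1 supplies the positive radius that
      \<open>higson_functionsD\<close> asks for, as \<open>r\<close> may be 0 or negative.\<close>
    let ?K = "\<Union>f\<in>F. {x \<in> M. \<exists>y\<in>M. d x y \<le> max r 1 \<and> \<epsilon> / 2 \<le> \<bar>f x - f y\<bar>}"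
    have "finite ?K"
      using F by (intro finite_UN_I higson_functionsD) auto
    then have "\<phi> \<in> corona_set (D - ?K)"
      using \<phi> corona_set_diff_finite[OF D] by simp
    then obtain x where x: "x \<in> D" "x \<notin> ?K" "\<forall>f\<in>F. \<bar>f x - \<phi> f\<bar> < \<epsilon> / 2"
    proof -
      have "\<exists>x\<in>D - ?K. \<forall>f\<in>F. \<bar>f x - \<phi> f\<bar> < \<epsilon> / 2"
        using \<open>\<phi> \<in> corona_set (D - ?K)\<close> by (rule corona_set_approx) (use D F in auto)
      then show ?thesis using that by blast
    qed
    have "\<bar>f (\<tau> x) - \<phi> f\<bar> < \<epsilon>" if f: "f \<in> F" for f
    proof -
      have "\<bar>f x - f (\<tau> x)\<bar> < \<epsilon> / 2"
        using x(1,2) f \<tau>[OF x(1)] D by force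
      moreover have "\<bar>f x - \<phi> f\<bar> < \<epsilon> / 2"
        using x f by blast
      ultimately show ?thesis by linarith
    qed
    then show ?thesis
      using x(1) by blast
  qed
  moreover have "\<tau> ` D \<subseteq> M" using \<tau> by blast
  ultimately have "\<phi> \<in> higson_product closure_of (higson_evaluation ` \<tau> ` D)"
    using \<phi> corona_set_subset[of D] higson_closure_iff[of "\<tau> ` D" \<phi>] by blast
  then show "\<phi> \<in> corona_set (\<tau> ` D)"
    using \<phi> unfolding corona_set_def by blast
qed

text \<open>For \<open>A = M\<close> this is the classical coboundary form of having at most one
  end. For the cone used later, the boundary is taken inside \<open>A\<close>, but with the distance
  of the whole space.\<close>

definition unsplittable :: "'a set \<Rightarrow> bool" where
  "unsplittable A \<longleftrightarrow>
     (\<forall>B\<subseteq>A. finite {x \<in> B. \<exists>y\<in>A - B. d x y \<le> 1} \<longrightarrow> finite B \<or> finite (A - B))"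

text \<open>A separation of the trace would divide \<open>A\<close> into two infinite parts, hence
  have infinitely many boundary pairs. Both ends of these pairs share a limit point, which would lie
  on both sides.\<close>

lemma connectedin_corona_set:
  assumes A: "A \<subseteq> M" and unsp: "unsplittable A"
  shows "connectedin higson_product (corona_set A)"
proof (rule ccontr)
  assume "\<not> ?thesis"
  then obtain E1 E2 where E: "closedin higson_product E1" "closedin higson_product E2"
    "corona_set A \<subseteq> E1 \<union> E2" "E1 \<inter> E2 \<inter> corona_set A = {}"
    "E1 \<inter> corona_set A \<noteq> {}" "E2 \<inter> corona_set A \<noteq> {}"
    using corona_set_subset[of A] unfolding connectedin_closedin by meson
  have cl: "closedin higson_product (E1 \<inter> corona_set A)" "closedin higson_product (E2 \<inter> corona_set A)"
    using E closedin_corona_set[OF A] by auto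
  have disj: "disjnt (E1 \<inter> corona_set A) (E2 \<inter> corona_set A)"
    using E(4) unfolding disjnt_def by blast
  \<comment> \<open>Normality thickens the separation to disjoint open sets of the product, which
    can then be pulled back to \<open>A\<close>.\<close>
  have "normal_space higson_product"
    using compact_space_higson_product Hausdorff_space_higson_product
      compact_Hausdorff_or_regular_imp_normal_space by blast
  then obtain U V where UV: "openin higson_product U" "openin higson_product V"
    "E1 \<inter> corona_set A \<subseteq> U" "E2 \<inter> corona_set A \<subseteq> V" "disjnt U V"
    using cl disj unfolding normal_space_def by meson
  then have UVd: "U \<inter> V = {}"
    by (simp add: disjnt_def)
  define B where "B = {x \<in> A. higson_evaluation x \<in> U}"
  have B: "B \<subseteq> A" "B \<subseteq> M" "A - B \<subseteq> M" "B \<union> (A - B) = A"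
    using A unfolding B_def by auto
  have avoid: "\<phi> \<notin> T" if "\<phi> \<in> corona_set D" "openin higson_product T" "T \<inter> higson_evaluation ` D = {}"
    for \<phi> T D
  proof
    assume "\<phi> \<in> T"
    moreover have "\<phi> \<in> higson_product closure_of (higson_evaluation ` D)"
      using that(1) by (simp add: corona_set_def)
    ultimately have "\<exists>y. y \<in> higson_evaluation ` D \<and> y \<in> T"
      using that(2) by (simp add: in_closure_of)
    then show False
      using that(3) by blast
  qed
  have E2B: "\<phi> \<in> E2" if "\<phi> \<in> corona_set (A - B)" for \<phi>
  proof -
    have "\<phi> \<notin> U"
      by (rule avoid[OF that UV(1)]) (auto simp: B_def)
    moreover have "\<phi> \<in> corona_set A"
      using that corona_set_mono[of "A - B" A] by blast
    ultimately show ?thesis using UV E by blast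
  qed
  have E1B: "\<phi> \<in> E1" if "\<phi> \<in> corona_set B" for \<phi>
  proof -
    have "\<phi> \<notin> V"
      by (rule avoid[OF that UV(2)]) (use UVd in \<open>auto simp: B_def\<close>)
    moreover have "\<phi> \<in> corona_set A"
      using that corona_set_mono[of B A] B by blast
    ultimately show ?thesis using UV E by blast
  qed
  have un: "corona_set A = corona_set B \<union> corona_set (A - B)"
    using corona_set_Un[of B "A - B"] B(4) by simp
  have "corona_set B \<noteq> {}" "corona_set (A - B) \<noteq> {}"
    using un E1B E2B E by blast+
  then have "infinite B" "infinite (A - B)"
    using corona_set_finite B by blast+
  then have inf: "infinite {x \<in> B. \<exists>y\<in>A - B. d x y \<le> 1}" (is "infinite ?D")
    using unsp B(1) unfolding unsplittable_def by blast
  \<comment> \<open>The map \<open>\<tau>\<close> sends each boundary point of \<open>B\<close>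
    across the boundary. By \<open>corona_set_shift\<close>, limits of its domain are limits of
    \<open>A - B\<close> as well.\<close>
  have "\<forall>x\<in>?D. \<exists>y. y \<in> A - B \<and> d x y \<le> 1" by blast
  from bchoice[OF this] obtain \<tau> where \<tau>: "\<And>x. x \<in> ?D \<Longrightarrow> \<tau> x \<in> A - B \<and> d x (\<tau> x) \<le> 1"
    by blast
  have "?D \<subseteq> M" using B by blast
  then obtain \<phi> where \<phi>: "\<phi> \<in> corona_set ?D"
    using corona_set_nonempty[OF _ inf] by blast
  have "\<phi> \<in> corona_set (\<tau> ` ?D)"
    using corona_set_shift[of ?D \<tau> 1] \<phi> \<tau> \<open>?D \<subseteq> M\<close> A by blast
  then have "\<phi> \<in> corona_set (A - B)"
    using corona_set_mono[of "\<tau> ` ?D" "A - B"] \<tau> by blast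
  moreover have "\<phi> \<in> corona_set B"
    using corona_set_mono[of ?D B] \<phi> by blast
  ultimately show False
    using E1B[of \<phi>] E2B[of \<phi>] E(4) un by blast
qed

lemma topspace_higson_corona: "topspace higson_corona = corona_set M"
  using corona_set_subset by (auto simp: higson_corona_eq)

theorem continuum_higson_corona_iff:
  "continuum higson_corona \<longleftrightarrow> infinite M \<and> unsplittable M"
proof
  assume c: "infinite M \<and> unsplittable M"
  have "compactin higson_product (corona_set M)"
    using closedin_compact_space compact_space_higson_product closedin_corona_set by blast
  then show "continuum higson_corona"
    using c corona_set_nonempty[of M] connectedin_corona_set[of M]
    unfolding continuum_def topspace_higson_corona
    by (simp add: higson_corona_eq compact_space_subtopology connectedin_def
        Hausdorff_space_subtopology Hausdorff_space_higson_product)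
next
  assume c: "continuum higson_corona"
  have "unsplittable M"
    unfolding unsplittable_def
  proof (intro allI impI)
    fix A assume A: "A \<subseteq> M" and fin: "finite {x \<in> A. \<exists>y\<in>M - A. d x y \<le> 1}"
    let ?f = "\<lambda>x\<in>M. of_bool (x \<in> A) :: real"
    have f: "?f \<in> higson_functions"
      using indicator_higson[OF A fin] .
    show "finite A \<or> finite (M - A)"
    proof (rule ccontr)
      assume "\<not> ?thesis"
      then obtain \<phi> \<psi> where ne: "\<phi> \<in> corona_set A" "\<psi> \<in> corona_set (M - A)"
        using corona_set_nonempty A by (metis Diff_subset ex_in_conv)
      have "\<phi> ?f \<in> {1}"
        by (rule corona_set_value[OF ne(1) A f])
          (use A in \<open>auto intro!: finite_subset[of _ "{}"] split: if_splits\<close>)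
      moreover have "\<psi> ?f \<in> {0}"
        by (rule corona_set_value[OF ne(2) _ f])
          (use A in \<open>auto intro!: finite_subset[of _ "{}"] split: if_splits\<close>)
      moreover have "\<phi> \<in> corona_set M" "\<psi> \<in> corona_set M"
        using ne corona_set_mono A Diff_subset by blast+
      moreover have "connected ((\<lambda>\<phi>. \<phi> ?f) ` corona_set M)"
      proof -
        have "connectedin higson_product (corona_set M)"
          using c corona_set_subset unfolding continuum_def higson_corona_eq connectedin_def by blast
        then have "connectedin euclideanreal ((\<lambda>\<phi>. \<phi> ?f) ` corona_set M)"
          by (rule connectedin_continuous_map_image[OF continuous_map_higson_coordinate[OF f]])
        then show ?thesis by simp
      qed
      \<comment> \<open>Connectedness forces an intermediate value, yet the indicator takes values
        in the closed set \<open>{0, 1}\<close>, and so does its coordinate on the corona.\<close>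
      ultimately have "1/2 \<in> (\<lambda>\<phi>. \<phi> ?f) ` corona_set M"
        using connectedD_interval[of "(\<lambda>\<phi>. \<phi> ?f) ` corona_set M" 0 1 "1/2"] by force
      then obtain \<theta> where "\<theta> \<in> corona_set M" "\<theta> ?f = 1/2" by auto
      moreover have "\<theta> ?f \<in> {0,1}" if "\<theta> \<in> corona_set M" for \<theta>
        by (rule corona_set_value[OF that _ f])
          (auto intro!: finite_subset[of _ "{}"] split: if_splits)
      ultimately show False by fastforce
    qed
  qed
  moreover have "infinite M"
    using c corona_set_finite unfolding continuum_def topspace_higson_corona by blast
  ultimately show "infinite M \<and> unsplittable M" by blast
qed

section \<open>Geodesics and decomposability\<close>

lemma distance_function:
  assumes A: "A \<subseteq> M" "A \<noteq> {}"
  obtains u where "\<And>x y. x \<in> M \<Longrightarrow> y \<in> M \<Longrightarrow> \<bar>u x - u y\<bar> \<le> d x y"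
    "\<And>a. a \<in> A \<Longrightarrow> u a = 0" "\<And>x. 0 \<le> u x"
    "\<And>x c. (\<And>a. a \<in> A \<Longrightarrow> c \<le> d x a) \<Longrightarrow> c \<le> u x"
proof
  let ?u = "\<lambda>x. INF a\<in>A. d x a"
  have bdd: "bdd_below (d x ` A)" for x
    by (rule bdd_belowI[of _ 0]) auto
  show ge: "c \<le> ?u x" if "\<And>a. a \<in> A \<Longrightarrow> c \<le> d x a" for x c
    using that A by (intro cINF_greatest)
  show nn: "0 \<le> ?u x" for x
    by (rule ge) simp
  have le: "?u x \<le> d x y + ?u y" if "x \<in> M" "y \<in> M" for x y
  proof -
    have "?u x - d x y \<le> d y a" if a: "a \<in> A" for a
    proof -
      have "?u x \<le> d x a" using bdd a by (rule cINF_lower)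
      also have "\<dots> \<le> d x y + d y a" using \<open>x \<in> M\<close> \<open>y \<in> M\<close> a A by (intro triangle) auto
      finally show ?thesis by simp
    qed
    then have "?u x - d x y \<le> ?u y" by (rule ge)
    then show ?thesis by simp
  qed
  show "\<bar>?u x - ?u y\<bar> \<le> d x y" if "x \<in> M" "y \<in> M" for x y
    using le[OF that] le[OF that(2,1)] commute[of x y] by linarith
  show "?u a = 0" if "a \<in> A" for a
  proof -
    have "?u a \<le> d a a" using bdd that by (rule cINF_lower)
    then show ?thesis using nn[of a] that A by (metis mdist_zero order_antisym subsetD)
  qed
qed

text \<open>Moving by \<open>r\<close> changes numerator and denominator by at most \<open>r\<close>
  each, while the quotient stays bounded; so it changes by a constant times
  \<open>r / d v x\<close>, which is small far out. The maximum with 1 avoids dividing by 0 at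
  \<open>v\<close>.\<close>

lemma slowly_varying_higson:
  assumes v: "v \<in> M" and lip: "\<And>x y. x \<in> M \<Longrightarrow> y \<in> M \<Longrightarrow> \<bar>u x - u y\<bar> \<le> d x y"
  shows "(\<lambda>x\<in>M. u x / max 1 (d v x)) \<in> higson_functions"
proof (rule higson_functionsI)
  let ?p = "\<lambda>x. max 1 (d v x)"
  let ?f = "\<lambda>x\<in>M. u x / ?p x"
  define K where "K = 1 + \<bar>u v\<bar>"
  have K: "K \<ge> 1" by (simp add: K_def)
  have bd: "\<bar>u x / ?p x\<bar> \<le> K" if "x \<in> M" for x
  proof -
    have "\<bar>u x\<bar> \<le> \<bar>u v\<bar> + d v x"
      using lip[OF v that] by linarith
    also have "\<dots> \<le> \<bar>u v\<bar> * ?p x + ?p x"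
      using mult_left_mono[of 1 "?p x" "\<bar>u v\<bar>"] by simp
    finally have "\<bar>u x\<bar> \<le> K * ?p x"
      by (simp add: K_def algebra_simps)
    then show ?thesis
      by (simp add: abs_div_pos[symmetric] divide_le_eq)
  qed
  show "?f \<in> extensional M" by simp
  show "bounded (?f ` M)"
    using bd by (auto simp: bounded_iff)
  fix r \<epsilon> :: real assume r: "r > 0" "\<epsilon> > 0"
  have "{x \<in> M. \<exists>y\<in>M. d x y \<le> r \<and> \<epsilon> \<le> \<bar>?f x - ?f y\<bar>} \<subseteq> mcball v (r * (1 + K) / \<epsilon>)"
  proof clarify
    fix x y assume xy: "x \<in> M" "y \<in> M" "d x y \<le> r" "\<epsilon> \<le> \<bar>?f x - ?f y\<bar>"
    define p q where "p = ?p x" and "q = ?p y"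
    have pq: "p > 0" "q > 0" by (auto simp: p_def q_def)
    have "\<bar>d v x - d v y\<bar> \<le> d x y"
      using triangle[OF v xy(1,2)] triangle[OF v xy(2,1)] commute[of x y] by linarith
    then have qp: "\<bar>q - p\<bar> \<le> r"
      using xy(3) by (simp add: p_def q_def max_def) linarith
    \<comment> \<open>This separates the change of the numerator from that of the denominator,
      leaving the bounded quotient \<open>u y / q\<close> as a factor.\<close>
    have "u x / p - u y / q = (u x - u y) / p + (u y / q) * ((q - p) / p)"
      using pq by (simp add: field_simps)
    then have "\<bar>u x / p - u y / q\<bar> \<le> \<bar>(u x - u y) / p\<bar> + \<bar>(u y / q) * ((q - p) / p)\<bar>"
      by (simp only: abs_triangle_ineq)
    also have "\<dots> = \<bar>u x - u y\<bar> / p + \<bar>u y / q\<bar> * (\<bar>q - p\<bar> / p)"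
      using pq by (simp add: abs_mult)
    also have "\<dots> \<le> r / p + K * (r / p)"
    proof (intro add_mono mult_mono divide_right_mono)
      show "\<bar>u x - u y\<bar> \<le> r" using lip[OF xy(1,2)] xy(3) by linarith
      show "\<bar>u y / q\<bar> \<le> K" using bd[OF xy(2)] by (simp add: q_def)
    qed (use pq qp K in auto)
    also have "\<dots> = r * (1 + K) / p"
      by (simp add: algebra_simps add_divide_distrib)
    finally have "\<bar>u x / p - u y / q\<bar> \<le> r * (1 + K) / p" .
    moreover have "\<epsilon> \<le> \<bar>u x / p - u y / q\<bar>"
      using xy by (simp add: p_def q_def)
    ultimately have "\<epsilon> \<le> r * (1 + K) / p" by linarith
    then have "p \<le> r * (1 + K) / \<epsilon>"
      using pq r by (simp add: field_simps)
    then show "x \<in> mcball v (r * (1 + K) / \<epsilon>)"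
      using v xy(1) by (simp add: p_def)
  qed
  then show "finite {x \<in> M. \<exists>y\<in>M. d x y \<le> r \<and> \<epsilon> \<le> \<bar>?f x - ?f y\<bar>}"
    using finite_mcball[OF v] finite_subset by blast
qed

text \<open>The distance to \<open>A\<close> divided by the distance to \<open>v\<close> vanishes on
  \<open>A\<close> and is at least \<open>c\<close> on \<open>Y\<close> away from \<open>v\<close>;
  limit points inherit both.\<close>

lemma corona_set_separate:
  assumes A: "A \<subseteq> M" and Y: "Y \<subseteq> M" and v: "v \<in> M" and c: "c > 0"
    and far: "\<And>y a. y \<in> Y \<Longrightarrow> a \<in> A \<Longrightarrow> c * d v y \<le> d y a"
  shows "corona_set A \<inter> corona_set Y = {}"
proof (cases "A = {}")
  case True
  then show ?thesis by (simp add: corona_set_finite)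
next
  case False
  obtain u where u: "\<And>x y. x \<in> M \<Longrightarrow> y \<in> M \<Longrightarrow> \<bar>u x - u y\<bar> \<le> d x y"
    "\<And>a. a \<in> A \<Longrightarrow> u a = 0" "\<And>x. 0 \<le> u x"
    "\<And>x c. (\<And>a. a \<in> A \<Longrightarrow> c \<le> d x a) \<Longrightarrow> c \<le> u x"
    using distance_function[OF A False] by metis
  let ?f = "\<lambda>x\<in>M. u x / max 1 (d v x)"
  have f: "?f \<in> higson_functions"
    using slowly_varying_higson[OF v u(1)] .
  show ?thesis
  proof (rule ccontr)
    assume "\<not> ?thesis"
    then obtain \<phi> where \<phi>: "\<phi> \<in> corona_set A" "\<phi> \<in> corona_set Y" by blast
    have "\<phi> ?f \<in> {0}"
      by (rule corona_set_value[OF \<phi>(1) A f])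
        (use A u(2) in \<open>auto intro!: finite_subset[of _ "{}"]\<close>)
    moreover have "\<phi> ?f \<in> {c..}"
    proof (rule corona_set_value[OF \<phi>(2) Y f])
      have "?f y \<in> {c..}" if y: "y \<in> Y" "y \<noteq> v" for y
      proof -
        have yM: "y \<in> M" using y Y by blast
        obtain n where n: "d v y = real n" using dist_Nats[OF v yM] by (metis Nats_cases)
        have "d v y \<noteq> 0" using y yM v by simp
        then have "d v y \<ge> 1" using n by auto
        moreover have "c * d v y \<le> u y" using far[OF y(1)] by (rule u(4))
        ultimately show ?thesis using yM by (simp add: max_def pos_le_divide_eq)
      qed
      then have "{y \<in> Y. ?f y \<notin> {c..}} \<subseteq> {v}"
        by blast
      then show "finite {y \<in> Y. ?f y \<notin> {c..}}"
        by (rule finite_subset) simp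
    qed auto
    ultimately show False using c by auto
  qed
qed

text \<open>Koenig's lemma for geodesics from \<open>v\<close> to points of \<open>D\<close>: keep a prefix that extends to
  infinitely many points of \<open>D\<close>.\<close>

lemma geodesic_ray:
  assumes v: "v \<in> M" and D: "D \<subseteq> M" "infinite D"
  obtains \<gamma> :: "nat \<Rightarrow> 'a" where "\<And>n. \<gamma> n \<in> M" "\<And>n. d v (\<gamma> n) = real n"
    "\<And>n. d (\<gamma> n) (\<gamma> (Suc n)) = 1" "\<And>n. \<exists>a\<in>D. d v a = real n + d (\<gamma> n) a"
proof -
  let ?C = "\<lambda>n x. {a \<in> D. d v a = real n + d x a}"
  let ?P = "\<lambda>n x. x \<in> M \<and> d v x = real n \<and> infinite (?C n x)"
  have "\<exists>\<gamma>. \<forall>n. ?P n (\<gamma> n) \<and> d (\<gamma> n) (\<gamma> (Suc n)) = 1"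
  proof (rule dependent_nat_choice)
    show "\<exists>x. ?P 0 x"
      using v D by (intro exI[of _ v]) auto
  next
    fix x n assume P: "?P n x"
    let ?S = "{y \<in> mcball x 1. d x y = 1 \<and> d v y = real (Suc n)}"
    \<comment> \<open>Each target other than \<open>x\<close> lies behind one of finitely many next
      vertices \<open>y\<close>, so some \<open>y\<close> inherits infinitely many targets. The
      point \<open>x\<close> is left out because no step leads from it towards itself.\<close>
    have "?C n x - {x} \<subseteq> (\<Union>y\<in>?S. ?C (Suc n) y)"
    proof
      fix a assume a: "a \<in> ?C n x - {x}"
      then have aM: "a \<in> M" using D by blast
      obtain z where z: "z \<in> M" "d x z = 1" "d z a = d x a - 1"
        using dist_step[of x a] P a aM by blast
      have "d v z \<le> d v x + d x z" "d v a \<le> d v z + d z a"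
        using triangle[of v x z] triangle[of v z a] P v z(1) aM by blast+
      then have "d v z = real (Suc n)"
        using z P a by auto
      then show "a \<in> (\<Union>y\<in>?S. ?C (Suc n) y)"
        using z P a by auto
    qed
    moreover have "infinite (?C n x - {x})"
      using P by simp
    moreover have "finite ?S"
      using P by (intro finite_subset[OF _ finite_mcball[of x 1]]) auto
    ultimately obtain y where "y \<in> ?S" "infinite (?C (Suc n) y)"
      by (meson finite_UN_I finite_subset)
    then show "\<exists>y. ?P (Suc n) y \<and> d x y = 1"
      by auto
  qed
  then obtain \<gamma> where \<gamma>: "\<And>n. ?P n (\<gamma> n) \<and> d (\<gamma> n) (\<gamma> (Suc n)) = 1"
    by blast
  have "?C n (\<gamma> n) \<noteq> {}" for n
    using \<gamma>[of n] infinite_imp_nonempty by blast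
  then show ?thesis
    using that[of \<gamma>] \<gamma> by blast
qed

lemma dist_steps_le:
  assumes "\<And>n. \<gamma> n \<in> M" "\<And>n. d (\<gamma> n) (\<gamma> (Suc n)) = 1"
  shows "d (\<gamma> m) (\<gamma> (m + k)) \<le> real k"
proof (induction k)
  case (Suc k)
  have "d (\<gamma> m) (\<gamma> (m + Suc k)) \<le> d (\<gamma> m) (\<gamma> (m + k)) + d (\<gamma> (m + k)) (\<gamma> (Suc (m + k)))"
    using assms(1) triangle by simp
  then show ?case
    using Suc assms(2)[of "m + k"] by simp
qed (use assms in simp)

lemma geodesic_line:
  assumes v: "v \<in> M" and inf: "infinite M"
    and homogeneous: "\<And>x y. x \<in> M \<Longrightarrow> y \<in> M \<Longrightarrow>
      \<exists>t. t x = y \<and> (\<forall>a\<in>M. t a \<in> M) \<and> (\<forall>a\<in>M. \<forall>b\<in>M. d (t a) (t b) = d a b)"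
  obtains g h :: "nat \<Rightarrow> 'a" where "\<And>n. g n \<in> M" "\<And>n. h n \<in> M"
    "\<And>n. d v (g n) = real n" "\<And>n. d v (h n) = real n"
    "\<And>n. d (h n) (h (Suc n)) = 1" "\<And>m k. real m + real k \<le> d (g m) (h k)"
proof -
  \<comment> \<open>Koenig's lemma again, growing geodesics with midpoint \<open>v\<close> at both ends.\<close>
  define D where "D = {(a, b). a \<in> M \<and> b \<in> M \<and> d a v = d v b \<and> d a b = d a v + d v b}"
  \<comment> \<open>The initial segment of length \<open>2 * n\<close> of a geodesic ray has
    midpoint \<open>\<gamma> n\<close>; a distance-preserving map carrying this midpoint to
    \<open>v\<close> yields a pair in \<open>D\<close>.\<close>
  have "\<exists>ab\<in>D. d (fst ab) v = real n" for n
  proof -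
    obtain \<gamma> where \<gamma>: "\<And>n. \<gamma> n \<in> M" "\<And>n. d v (\<gamma> n) = real n" "\<And>n. d (\<gamma> n) (\<gamma> (Suc n)) = 1"
      using geodesic_ray[OF v order_refl inf] by metis
    obtain t where t: "t (\<gamma> n) = v" "\<And>a. a \<in> M \<Longrightarrow> t a \<in> M"
      "\<And>a b. a \<in> M \<Longrightarrow> b \<in> M \<Longrightarrow> d (t a) (t b) = d a b"
      using homogeneous[OF \<gamma>(1)[of n] v] by blast
    have "d (\<gamma> n) (\<gamma> (2 * n)) \<le> real n"
      using dist_steps_le[of \<gamma> n n] \<gamma>(1,3) by (simp add: mult_2)
    moreover have "d v (\<gamma> (2 * n)) \<le> d v (\<gamma> n) + d (\<gamma> n) (\<gamma> (2 * n))"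
      using \<gamma> v by (intro triangle)
    ultimately have mid: "d (\<gamma> n) (\<gamma> (2 * n)) = real n"
      using \<gamma>(2)[of n] \<gamma>(2)[of "2 * n"] by simp
    have "d (t v) v = real n" "d v (t (\<gamma> (2 * n))) = real n" "d (t v) (t (\<gamma> (2 * n))) = real (2 * n)"
      using t(3)[OF v \<gamma>(1)[of n]] t(3)[OF \<gamma>(1)[of n] \<gamma>(1)[of "2 * n"]]
        t(3)[OF v \<gamma>(1)[of "2 * n"]] t(1) \<gamma>(2)[of n] \<gamma>(2)[of "2 * n"] mid by simp_all
    then have "(t v, t (\<gamma> (2 * n))) \<in> D"
      using t(2)[OF v] t(2)[OF \<gamma>(1)] unfolding D_def by simp
    then show ?thesis
      using \<open>d (t v) v = real n\<close> by force
  qed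
  then have "range real \<subseteq> (\<lambda>ab. d (fst ab) v) ` D"
    by (metis (no_types, lifting) image_eqI image_subsetI)
  moreover have "infinite (range real)"
    using finite_imageD inj_of_nat by blast
  ultimately have infD: "infinite D"
    by (meson finite_imageI finite_subset)
  \<comment> \<open>When \<open>x\<close> and \<open>y\<close> are at distance \<open>n\<close> from
    \<open>v\<close>, the equation says that some geodesic from \<open>a\<close> to \<open>b\<close>
    runs through \<open>x\<close>, \<open>v\<close> and \<open>y\<close> in this order.\<close>
  let ?C = "\<lambda>n x y. {(a, b) \<in> D. d a b = d a x + 2 * real n + d y b}"
  let ?P = "\<lambda>n xy. fst xy \<in> M \<and> snd xy \<in> M \<and> d v (fst xy) = real n \<and> d v (snd xy) = real n
    \<and> infinite (?C n (fst xy) (snd xy))"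
  let ?Q = "\<lambda>xy xy'. d (fst xy) (fst xy') = 1 \<and> d (snd xy) (snd xy') = 1"
  have "\<exists>\<gamma>. \<forall>n::nat. ?P n (\<gamma> n) \<and> ?Q (\<gamma> n) (\<gamma> (Suc n))"
  proof (rule dependent_nat_choice[where P = ?P and Q = "\<lambda>_. ?Q"])
    have "?C 0 v v = D"
      unfolding D_def by auto
    then show "\<exists>xy. ?P 0 xy"
      using v infD by (intro exI[of _ "(v, v)"]) simp
  next
    fix xy n assume P': "?P n xy"
    obtain x y where xy: "xy = (x, y)" by fastforce
    have P: "x \<in> M" "y \<in> M" "d v x = real n" "d v y = real n" "infinite (?C n x y)"
      using P' by (simp_all add: xy)
    \<comment> \<open>Both ends of a pair in \<open>D\<close> are equally far from \<open>v\<close>.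
      So a pair outside this finite set has both ends beyond distance \<open>n\<close>, and the
      geodesic can be extended on both sides.\<close>
    let ?F = "mcball v (real n) \<times> mcball v (real n)"
    let ?S = "{zw \<in> mcball x 1 \<times> mcball y 1. ?Q (x, y) zw \<and>
      d v (fst zw) = real (Suc n) \<and> d v (snd zw) = real (Suc n)}"
    have "?C n x y - ?F \<subseteq> (\<Union>zw\<in>?S. ?C (Suc n) (fst zw) (snd zw))"
    proof
      fix c assume "c \<in> ?C n x y - ?F"
      then obtain a b where c: "c = (a, b)" and ab: "(a, b) \<notin> ?F" "(a, b) \<in> D"
        "d a b = d a x + 2 * real n + d y b"
        by blast
      have abM: "a \<in> M" "b \<in> M" "d a v = d v b" "d a b = d a v + d v b"
        using ab(2) by (auto simp: D_def)
      have "a \<noteq> x" "b \<noteq> y"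
        using ab(1) abM P v commute[of a v] by auto
      then obtain z w where zw: "z \<in> M" "d x z = 1" "d z a = d x a - 1"
        "w \<in> M" "d y w = 1" "d w b = d y b - 1"
        using dist_step[of x a] dist_step[of y b] P abM by blast
      have "d v z \<le> d v x + d x z" "d v w \<le> d v y + d y w"
        "d a v \<le> d a z + d z v" "d v b \<le> d v w + d w b"
        using triangle[of v x z] triangle[of v y w] triangle[of a z v] triangle[of v w b] P v zw(1,4) abM
        by blast+
      then have "d v z = real (Suc n)" "d v w = real (Suc n)"
        using zw P ab abM commute[of v z] commute[of a x] commute[of a z] by simp_all
      then have S: "(z, w) \<in> ?S"
        using zw P by simp
      have "d a b = d a z + 2 * real (Suc n) + d w b"
        using ab(3) zw commute[of a x] commute[of a z] by simp
      then show "c \<in> (\<Union>zw\<in>?S. ?C (Suc n) (fst zw) (snd zw))"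
        unfolding c using ab(2) by (intro UN_I[OF S]) simp
    qed
    moreover have "infinite (?C n x y - ?F)"
      using P(5) finite_mcball[OF v] by (intro Diff_infinite_finite) auto
    moreover have "finite ?S"
      using finite_mcball P by (intro finite_subset[OF Collect_subset] finite_cartesian_product) auto
    ultimately obtain zw where "zw \<in> ?S" "infinite (?C (Suc n) (fst zw) (snd zw))"
      by (meson finite_UN_I finite_subset)
    then show "\<exists>zw. ?P (Suc n) zw \<and> ?Q xy zw"
      unfolding xy by (intro exI[of _ zw]) auto
  qed
  then obtain \<gamma> where \<gamma>: "\<And>n. ?P n (\<gamma> n)" "\<And>n. ?Q (\<gamma> n) (\<gamma> (Suc n))"
    by blast
  define g h where "g n = fst (\<gamma> n)" and "h n = snd (\<gamma> n)" for n
  have gh: "g n \<in> M" "h n \<in> M" "d v (g n) = real n" "d v (h n) = real n"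
    "d (g n) (g (Suc n)) = 1" "d (h n) (h (Suc n)) = 1" for n
    using \<gamma>(1)[of n] \<gamma>(2)[of n] by (simp_all add: g_def h_def)
  have diag: "2 * real n \<le> d (g n) (h n)" for n
  proof -
    have "?C n (g n) (h n) \<noteq> {}"
      using \<gamma>(1)[of n] infinite_imp_nonempty unfolding g_def h_def by blast
    then obtain a b where ab: "a \<in> M" "b \<in> M" "d a b = d a (g n) + 2 * real n + d (h n) b"
      unfolding D_def by blast
    have "d a b \<le> d a (g n) + d (g n) b" "d (g n) b \<le> d (g n) (h n) + d (h n) b"
      using triangle[of a "g n" b] triangle[of "g n" "h n" b] ab(1,2) gh(1,2) by blast+
    then show ?thesis using ab(3) by linarith
  qed
  have "real m + real k \<le> d (g m) (h k)" for m k
  proof -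
    \<comment> \<open>Walk back from the diagonal estimate at \<open>?n\<close>: removing
      \<open>?n - m\<close> steps of \<open>g\<close> and \<open>?n - k\<close> steps of
      \<open>h\<close> from \<open>2 * ?n\<close> leaves \<open>m + k\<close>.\<close>
    let ?n = "max m k"
    have "d (g m) (g ?n) \<le> real (?n - m)" "d (h k) (h ?n) \<le> real (?n - k)"
      using dist_steps_le[of g m "?n - m"] dist_steps_le[of h k "?n - k"] gh by simp_all
    moreover have "d (g ?n) (h ?n) \<le> d (g ?n) (g m) + d (g m) (h ?n)"
      "d (g m) (h ?n) \<le> d (g m) (h k) + d (h k) (h ?n)"
      using triangle[of "g ?n" "g m" "h ?n"] triangle[of "g m" "h k" "h ?n"] gh(1,2) by blast+
    moreover have "real (?n - m) = real ?n - real m" "real (?n - k) = real ?n - real k"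
      by (simp_all add: of_nat_diff)
    ultimately show ?thesis
      using diag[of ?n] commute[of "g ?n" "g m"] by linarith
  qed
  then show ?thesis
    using that[of g h] gh by blast
qed

section \<open>The cone around one half of a geodesic line\<close>

theorem decomposable_higson_corona:
  assumes inf: "infinite M" and unsp: "unsplittable M"
    and homogeneous: "\<And>x y. x \<in> M \<Longrightarrow> y \<in> M \<Longrightarrow>
      \<exists>t. t x = y \<and> (\<forall>a\<in>M. t a \<in> M) \<and> (\<forall>a\<in>M. \<forall>b\<in>M. d (t a) (t b) = d a b)"
  shows "decomposable higson_corona"
proof -
  obtain v where v: "v \<in> M"
    using inf infinite_imp_nonempty by blast
  obtain g h where g: "\<And>n. g n \<in> M" "\<And>n. d v (g n) = real n"
    and h: "\<And>n. h n \<in> M" "\<And>n. d v (h n) = real n" "\<And>n. d (h n) (h (Suc n)) = 1"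
    and gh: "\<And>m k. real m + real k \<le> d (g m) (h k)"
    using geodesic_line[OF v inf homogeneous] by metis
  define A where "A = {x \<in> M. \<exists>k. 2 * d x (h k) \<le> real k}"
  have AM: "A \<subseteq> M" by (auto simp: A_def)
  have hA: "h k \<in> A" for k
    using h by (auto simp: A_def intro!: exI[of _ k])
  have infinite_range: "infinite (range \<gamma>)" if "\<And>n. d v (\<gamma> n) = real n" for \<gamma> :: "nat \<Rightarrow> 'a"
    using that by (intro range_inj_infinite injI) (metis of_nat_eq_iff)
  have "unsplittable A"
    unfolding unsplittable_def
  proof (intro allI impI)
    fix B assume B: "B \<subseteq> A" and fin: "finite {x \<in> B. \<exists>y\<in>A - B. d x y \<le> 1}" (is "finite ?E")
    define R where "R = Max (insert 0 (d v ` ?E))"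
    have R: "d v x \<le> R" if "x \<in> ?E" for x
      unfolding R_def using fin that by (intro Max_ge) auto
    \<comment> \<open>The set \<open>?E\<close> records only the end in \<open>B\<close> of a
      boundary pair, hence both points are required to lie beyond \<open>R\<close>.\<close>
    have same: "x \<in> B \<longleftrightarrow> y \<in> B"
      if "x \<in> A" "y \<in> A" "d x y \<le> 1" "R < d v x" "R < d v y" for x y
    proof -
      have "d y x \<le> 1" using that commute by simp
      then have "x \<in> ?E \<or> y \<in> ?E \<or> (x \<in> B \<longleftrightarrow> y \<in> B)"
        using that by blast
      then show ?thesis using R[of x] R[of y] that by linarith
    qed
    obtain N :: nat where N: "R < real N"
      using reals_Archimedean2 by blast
    have ray: "h (N + k) \<in> B \<longleftrightarrow> h N \<in> B" for k
    proof (induction k)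
      case (Suc k)
      have "h (N + k) \<in> B \<longleftrightarrow> h (Suc (N + k)) \<in> B"
        by (rule same) (use hA h N in auto)
      then show ?case using Suc by simp
    qed simp
    \<comment> \<open>Along a geodesic from \<open>x\<close> to \<open>h k\<close> the distance to
      \<open>h k\<close> decreases, so it stays in the cone, and it stays at distance at least
      \<open>k / 2 > R\<close> from \<open>v\<close>, out of reach of the boundary of
      \<open>B\<close>.\<close>
    have toward_ray: "x \<in> B \<longleftrightarrow> h k \<in> B"
      if "x \<in> M" "d x (h k) = real n" "2 * real n \<le> real k" "2 * R < real k" for x k n
      using that
    proof (induction n arbitrary: x)
      case 0
      then show ?case using h by simp
    next
      case (Suc n)
      then have "x \<noteq> h k" using h by auto
      then obtain z where z: "z \<in> M" "d x z = 1" "d z (h k) = real n"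
        using dist_step[of x "h k"] Suc.prems h by auto
      have far: "R < d v w" if "w \<in> M" "d w (h k) \<le> real k / 2" for w
        using triangle[OF v that(1) h(1)[of k]] that(2) h(2)[of k] Suc.prems(4) by linarith
      have "x \<in> A" "z \<in> A"
        using Suc.prems z by (auto simp: A_def intro!: exI[of _ k])
      moreover have "R < d v x" "R < d v z"
        using Suc.prems z by (auto intro!: far)
      ultimately have "x \<in> B \<longleftrightarrow> z \<in> B"
        using z(2) same by simp
      moreover have "z \<in> B \<longleftrightarrow> h k \<in> B"
        using Suc.IH[of z] Suc.prems z by simp
      ultimately show ?case by simp
    qed
    \<comment> \<open>Since \<open>d v x \<le> k + k / 2\<close>, the threshold \<open>3 * N\<close>
      forces \<open>k > 2 * N > 2 * R\<close>. Then \<open>x\<close> is joined to \<open>h k\<close>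
      and \<open>h k\<close> to \<open>h N\<close> beyond the boundary.\<close>
    have const: "x \<in> B \<longleftrightarrow> h N \<in> B" if x: "x \<in> A" "3 * real N < d v x" for x
    proof -
      obtain k where k: "2 * d x (h k) \<le> real k" and xM: "x \<in> M"
        using x(1) by (auto simp: A_def)
      obtain n where n: "d x (h k) = real n"
        using dist_Nats[OF xM h(1)] by (metis Nats_cases)
      have "d v x \<le> d v (h k) + d (h k) x"
        using v xM h by (intro triangle)
      then have k2: "2 * real N < real k"
        using x(2) k h(2)[of k] commute[of x "h k"] by linarith
      then have "x \<in> B \<longleftrightarrow> h k \<in> B"
        using toward_ray[OF xM n] k n N by linarith
      then show ?thesis
        using ray[of "k - N"] k2 by simp
    qed
    have "B \<subseteq> mcball v (3 * real N) \<or> A - B \<subseteq> mcball v (3 * real N)"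
      using const B AM v by (auto simp: subset_iff not_le[symmetric])
    then show "finite B \<or> finite (A - B)"
      using finite_mcball[OF v] finite_subset by blast
  qed
  then have conn: "connectedin higson_corona (corona_set A)"
    using connectedin_corona_set[OF AM] corona_set_mono[OF AM]
    by (simp add: higson_corona_eq connectedin_subtopology)
  have closedin_trace: "closedin higson_corona (corona_set B)" if "B \<subseteq> M" for B
    using closedin_corona_set[OF that] corona_set_mono[OF that]
    by (metis higson_corona_eq closedin_subset_topspace corona_set_subset)
  \<comment> \<open>For \<open>a\<close> within \<open>k / 2\<close> of \<open>h k\<close>, the line
    estimate gives \<open>d (g m) a \<ge> m + k - k / 2 \<ge> m\<close>, so the separation constant
    is 1.\<close>
  have "corona_set A \<inter> corona_set (range g) = {}"
  proof (rule corona_set_separate[OF AM _ v zero_less_one])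
    show "range g \<subseteq> M" using g by blast
    fix y a assume "y \<in> range g" "a \<in> A"
    then obtain m k where y: "y = g m" and k: "2 * d a (h k) \<le> real k" and a: "a \<in> M"
      by (auto simp: A_def)
    show "1 * d v y \<le> d y a"
      using gh[of m k] triangle[OF g(1)[of m] a h(1)[of k]] k g(2)[of m] unfolding y by simp
  qed
  moreover have "corona_set (range g) \<noteq> {}"
    using g infinite_range by (intro corona_set_nonempty) auto
  moreover have "corona_set (range g) \<subseteq> corona_set M"
    using g by (intro corona_set_mono) auto
  ultimately have proper: "corona_set A \<noteq> topspace higson_corona"
    unfolding topspace_higson_corona by blast
  \<comment> \<open>The constant 1/2 is the slope of the cone. The complement of this trace is the
    open set that meets the limits of \<open>h\<close> and lies inside the trace of
    \<open>A\<close>.\<close>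
  have "corona_set (M - A) \<inter> corona_set (range h) = {}"
  proof (rule corona_set_separate[OF _ _ v, of _ _ "1/2"])
    show "range h \<subseteq> M" using h by blast
    fix y a assume "y \<in> range h" "a \<in> M - A"
    then obtain k where y: "y = h k" and a: "\<not> 2 * d a (h k) \<le> real k"
      by (auto simp: A_def)
    show "1 / 2 * d v y \<le> d y a"
      using a h(2)[of k] commute[of y a] unfolding y by simp
  qed auto
  moreover have "corona_set (range h) \<noteq> {}"
    using h infinite_range by (intro corona_set_nonempty) auto
  moreover have "corona_set (range h) \<subseteq> corona_set M"
    using h by (intro corona_set_mono) auto
  ultimately have ne: "topspace higson_corona - corona_set (M - A) \<noteq> {}"
    unfolding topspace_higson_corona by blast
  have "corona_set M = corona_set A \<union> corona_set (M - A)"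
    using corona_set_Un[of A "M - A"] AM by (simp add: Un_absorb1)
  then have sub: "topspace higson_corona - corona_set (M - A) \<subseteq> corona_set A"
    unfolding topspace_higson_corona by blast
  show ?thesis
    using decomposable_if_proper_subcontinuum[OF _ closedin_trace[OF AM] conn proper _ sub ne]
      continuum_higson_corona_iff inf unsp closedin_trace[of "M - A"] by (simp add: openin_diff)
qed

end

section \<open>Ends of the Cayley graph\<close>

locale cayley_graph_of_group = group G for G (structure) +
  fixes S
  assumes finite_S: "finite S" and S_carrier: "S \<subseteq> carrier G" and generate_S: "generate G S = carrier G"
begin

abbreviation "wd \<equiv> word_dist G S"
abbreviation "letters \<equiv> S \<union> m_inv G ` S"

lemma letters_carrier: "letters \<subseteq> carrier G"
  using S_carrier by auto

lemma word_dist_left_mult: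
  assumes "k \<in> carrier G" "g \<in> carrier G" "h \<in> carrier G"
  shows "wd (k \<otimes> g) (k \<otimes> h) = wd g h"
proof -
  have "inv (k \<otimes> g) \<otimes> (k \<otimes> h) = inv g \<otimes> (inv k \<otimes> (k \<otimes> h))"
    using assms by (simp add: inv_mult_group m_assoc)
  also have "\<dots> = inv g \<otimes> h"
    using assms by (simp add: m_assoc[symmetric])
  finally show ?thesis
    using assms by (simp add: word_dist_def)
qed

lemma word_dist_le_length:
  assumes "g \<in> carrier G" "set ws \<subseteq> letters"
  shows "wd g (g \<otimes> foldr (\<otimes>) ws \<one>) \<le> real (length ws)"
proof -
  have "foldr (\<otimes>) ws \<one> \<in> carrier G"
    using assms letters_carrier foldr_mult_closed by blast
  then have "wd g (g \<otimes> foldr (\<otimes>) ws \<one>) = real (word_length G S (foldr (\<otimes>) ws \<one>))"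
    using assms by (simp add: word_dist_def m_assoc[symmetric])
  then show ?thesis
    using word_length_le[OF assms(2)] by simp
qed

lemma geodesic_word:
  assumes "g \<in> carrier G" "h \<in> carrier G"
  obtains ws where "set ws \<subseteq> letters" "h = g \<otimes> foldr (\<otimes>) ws \<one>" "wd g h = real (length ws)"
proof -
  obtain ws where ws: "set ws \<subseteq> letters" "foldr (\<otimes>) ws \<one> = inv g \<otimes> h"
    "length ws = word_length G S (inv g \<otimes> h)"
    using shortest_word[OF S_carrier generate_S, of "inv g \<otimes> h"] assms by auto
  moreover have "h = g \<otimes> (inv g \<otimes> h)"
    using assms by (simp add: m_assoc[symmetric])
  ultimately show ?thesis
    using that[of ws] assms by (simp add: word_dist_def)
qed

sublocale W: Metric_space "carrier G" wd
  by (rule Metric_space_word_dist[OF is_group S_carrier generate_S])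

text \<open>The first letter of a geodesic word gives the next vertex, and balls are finite because
  there are finitely many words of bounded length.\<close>

sublocale W: proper_graph_space "carrier G" wd
proof
  show "wd x y \<in> \<nat>" for x y
    by (auto simp: word_dist_def)
next
  fix x y assume xy: "x \<in> carrier G" "y \<in> carrier G" "x \<noteq> y"
  obtain ws where ws: "set ws \<subseteq> letters" "y = x \<otimes> foldr (\<otimes>) ws \<one>" "wd x y = real (length ws)"
    using geodesic_word[OF xy(1,2)] .
  then obtain c vs where c: "ws = c # vs"
    using xy by (cases ws) auto
  have cG: "c \<in> carrier G" "foldr (\<otimes>) vs \<one> \<in> carrier G"
    using ws(1) letters_carrier foldr_mult_closed[of vs] by (auto simp: c)
  let ?z = "x \<otimes> c"
  have z: "?z \<in> carrier G" using cG xy by simp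
  have "wd x ?z \<le> 1"
    using word_dist_le_length[OF xy(1), of "[c]"] ws(1) cG by (simp add: c)
  moreover have "y = ?z \<otimes> foldr (\<otimes>) vs \<one>"
    using ws(2) xy cG by (simp add: c m_assoc)
  then have "wd ?z y \<le> wd x y - 1"
    using word_dist_le_length[OF z, of vs] ws(1,3) by (simp add: c)
  moreover have "wd x y \<le> wd x ?z + wd ?z y"
    using xy z by (intro W.triangle)
  ultimately show "\<exists>z\<in>carrier G. wd x z = 1 \<and> wd z y = wd x y - 1"
    using z by (intro bexI[of _ ?z]) auto
next
  fix x and r :: real assume x: "x \<in> carrier G"
  let ?W = "{ws. set ws \<subseteq> letters \<and> length ws \<le> nat \<lfloor>r\<rfloor>}"
  have "W.mcball x r \<subseteq> (\<lambda>ws. x \<otimes> foldr (\<otimes>) ws \<one>) ` ?W"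
  proof
    fix y assume y: "y \<in> W.mcball x r"
    then obtain ws where "set ws \<subseteq> letters" "y = x \<otimes> foldr (\<otimes>) ws \<one>" "wd x y = real (length ws)"
      using geodesic_word[OF x, of y] by auto
    moreover from this have "length ws \<le> nat \<lfloor>r\<rfloor>"
      using y by (simp add: le_nat_floor)
    ultimately show "y \<in> (\<lambda>ws. x \<otimes> foldr (\<otimes>) ws \<one>) ` ?W"
      by blast
  qed
  moreover have "finite ?W"
    using finite_S by (intro finite_lists_length_le) auto
  ultimately show "finite (W.mcball x r)"
    by (meson finite_imageI finite_subset)
qed

section \<open>Segments of the Cayley graph\<close>

sublocale X: Metric_space "cayley_points G S" "cayley_dist G S"
  by (rule Metric_space_cayley_dist[OF is_group S_carrier generate_S])

abbreviation "\<Gamma> \<equiv> cayley_graph G S"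

lemma topspace_cayley_graph: "topspace \<Gamma> = cayley_points G S"
  by (simp add: cayley_graph_def)

lemma Hausdorff_cayley_graph: "Hausdorff_space \<Gamma>"
  by (simp add: cayley_graph_def X.Hausdorff_space_mtopology)

lemma edge_point_swap: "edge_point g h t = edge_point h g (1 - t)"
  by (auto simp: edge_point_def)

lemma edge_point_same: "edge_point g g t = edge_point g g 0"
  by (auto simp: edge_point_def)

lemma vertex_in_points: "g \<in> carrier G \<Longrightarrow> edge_point g g 0 \<in> cayley_points G S"
  by (auto simp: cayley_points_def)

text \<open>Edges are recorded only in the direction of a generator while the word metric is
  symmetric, hence the two orientations. Equal vertices span a degenerate segment, which lets
  vertices and edges be treated alike.\<close>

lemma adjacent_cases:
  assumes "g \<in> carrier G" "h \<in> carrier G" "wd g h \<le> 1"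
  obtains "g = h" | s where "s \<in> S" "h = g \<otimes> s" | s where "s \<in> S" "g = h \<otimes> s"
proof -
  obtain ws where ws: "set ws \<subseteq> letters" "h = g \<otimes> foldr (\<otimes>) ws \<one>" "wd g h = real (length ws)"
    using geodesic_word[OF assms(1,2)] .
  have "ws = [] \<or> (\<exists>c. ws = [c])"
    using ws(3) assms(3) by (cases ws) auto
  then show ?thesis
  proof
    assume "ws = []"
    then show ?thesis using that(1) ws(2) assms by simp
  next
    assume "\<exists>c. ws = [c]"
    then obtain c where c: "ws = [c]" by blast
    then have cG: "c \<in> carrier G" and h: "h = g \<otimes> c"
      using ws letters_carrier by auto
    have "c \<in> S \<or> (\<exists>s\<in>S. c = inv s)" using ws(1) c by auto
    then show ?thesis
    proof
      assume "c \<in> S"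
      then show ?thesis using that(2) h by blast
    next
      assume "\<exists>s\<in>S. c = inv s"
      then obtain s where s: "s \<in> S" "c = inv s" by blast
      then have "s \<in> carrier G" using S_carrier by blast
      then have "g = h \<otimes> s" using h s assms by (simp add: m_assoc)
      then show ?thesis using that(3) s by blast
    qed
  qed
qed

lemma edge_dist_le_1:
  assumes "g \<in> carrier G" "s \<in> S"
  shows "wd g (g \<otimes> s) \<le> 1"
proof -
  have "s \<in> carrier G" using assms S_carrier by blast
  then show ?thesis using word_dist_le_length[OF assms(1), of "[s]"] assms by simp
qed

text \<open>An inequality for the length, because on a degenerate segment the path has length 0. A
  reversed edge is run through with parameter \<open>1 - t\<close>.\<close>

lemma segment_path:
  assumes "g \<in> carrier G" "h \<in> carrier G" "wd g h \<le> 1" "t \<in> {0..1}" "t' \<in> {0..1}"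
  shows "\<exists>l\<le>\<bar>t' - t\<bar>. cayley_path G S (edge_point g h t) l (edge_point g h t')"
  using assms(1-3)
proof (cases rule: adjacent_cases)
  case 1
  have "cayley_path G S (edge_point g g 0) 0 (edge_point g g 0)"
    using vertex_in_points[OF assms(1)] by (rule cayley_path.refl)
  then show ?thesis
    using edge_point_same[of g t] edge_point_same[of g t'] 1 by (intro exI[of _ 0]) auto
next
  case (2 s)
  then show ?thesis
    using cayley_path_edge[of g G s S t t'] assms by auto
next
  case (3 s)
  have "cayley_path G S (edge_point h g (1 - t)) \<bar>(1 - t') - (1 - t)\<bar> (edge_point h g (1 - t'))"
    using 3 assms by (simp only: 3, intro cayley_path_edge) auto
  then show ?thesis
    unfolding edge_point_swap[of g h t] edge_point_swap[of g h t']
    by (intro exI[of _ "\<bar>(1 - t') - (1 - t)\<bar>"]) simp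
qed

lemma cayley_path_points: "cayley_path G S x l y \<Longrightarrow> x \<in> cayley_points G S \<and> y \<in> cayley_points G S"
proof (induction rule: cayley_path.induct)
  case (step x l g s t t')
  then show ?case unfolding cayley_points_def by blast
qed simp

lemma cayley_dist_le:
  assumes "cayley_path G S x l y"
  shows "cayley_dist G S x y \<le> l"
proof -
  have "0 \<le> l'" if "cayley_path G S x l' y" for l'
    using cayley_path_lower_bound[OF that, of undefined] by simp
  then have "bdd_below {l. cayley_path G S x l y}"
    by (intro bdd_belowI[of _ 0]) auto
  then have "Inf {l. cayley_path G S x l y} \<le> l"
    using assms by (intro cInf_lower) auto
  then show ?thesis
    using cayley_path_points[OF assms] by (simp add: cayley_dist_def)
qed

lemma segment_lipschitz:
  assumes "g \<in> carrier G" "h \<in> carrier G" "wd g h \<le> 1" "t \<in> {0..1}" "t' \<in> {0..1}"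
  shows "edge_point g h t \<in> cayley_points G S"
    and "cayley_dist G S (edge_point g h t) (edge_point g h t') \<le> \<bar>t' - t\<bar>"
  using segment_path[OF assms] cayley_path_points cayley_dist_le by (blast, fastforce)

lemma cayley_points_cases:
  assumes "x \<in> cayley_points G S"
  obtains g h t where "g \<in> carrier G" "h \<in> carrier G" "wd g h \<le> 1" "t \<in> {0..1}" "x = edge_point g h t"
  using assms unfolding cayley_points_def
proof
  assume "x \<in> {edge_point g g 0 |g. g \<in> carrier G}"
  then show ?thesis using that[of _ _ 0] by auto
next
  assume "x \<in> {edge_point g (g \<otimes> s) t |g s t. g \<in> carrier G \<and> s \<in> S \<and> t \<in> {0..1}}"
  then obtain g s t where "x = edge_point g (g \<otimes> s) t" "g \<in> carrier G" "s \<in> S" "t \<in> {0..1}"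
    by blast
  then show ?thesis using that[of g "g \<otimes> s" t] edge_dist_le_1 S_carrier by auto
qed

text \<open>Points are barycentric coordinates, so this weighted sum interpolates \<open>u\<close>
  linearly along each edge; at most two terms are nonzero.\<close>

definition affine_extension :: "('a \<Rightarrow> real) \<Rightarrow> ('a \<Rightarrow> real) \<Rightarrow> real" where
  "affine_extension u x = (\<Sum>v | x v \<noteq> 0. x v * u v)"

lemma affine_extension_edge: "affine_extension u (edge_point g h t) = (1 - t) * u g + t * u h"
proof -
  let ?e = "edge_point g h t"
  have "affine_extension u ?e = (\<Sum>v\<in>{g, h}. ?e v * u v)"
    unfolding affine_extension_def
    by (rule sum.mono_neutral_left) (auto simp: edge_point_def)
  also have "\<dots> = (1 - t) * u g + t * u h"
    by (cases "g = h") (auto simp: edge_point_def algebra_simps)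
  finally show ?thesis .
qed

text \<open>The slope on each edge is at most 1, so the change along a path is bounded by its
  length. The hypothesis fits both the word norm and the indicator of any set of vertices.\<close>

lemma affine_extension_lipschitz:
  assumes u: "\<And>g h. g \<in> carrier G \<Longrightarrow> h \<in> carrier G \<Longrightarrow> wd g h \<le> 1 \<Longrightarrow> \<bar>u g - u h\<bar> \<le> 1"
    and x: "x \<in> cayley_points G S" and y: "y \<in> cayley_points G S"
  shows "\<bar>affine_extension u y - affine_extension u x\<bar> \<le> cayley_dist G S x y"
proof -
  have path: "\<bar>affine_extension u y - affine_extension u x\<bar> \<le> l" if "cayley_path G S x l y" for x y l
    using that
  proof (induction rule: cayley_path.induct)
    case (step x l g s t t')
    let ?h = "g \<otimes> s"
    have "?h \<in> carrier G" "wd g ?h \<le> 1"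
      using step S_carrier edge_dist_le_1 by auto
    then have "\<bar>u g - u ?h\<bar> \<le> 1" using u step by blast
    then have "\<bar>t' - t\<bar> * \<bar>u ?h - u g\<bar> \<le> \<bar>t' - t\<bar>"
      using mult_left_mono[of "\<bar>u ?h - u g\<bar>" 1 "\<bar>t' - t\<bar>"] by (simp add: abs_minus_commute)
    moreover have "affine_extension u (edge_point g ?h t') - affine_extension u (edge_point g ?h t)
      = (t' - t) * (u ?h - u g)"
      by (simp add: affine_extension_edge algebra_simps)
    ultimately have "\<bar>affine_extension u (edge_point g ?h t') - affine_extension u (edge_point g ?h t)\<bar> \<le> \<bar>t' - t\<bar>"
      by (simp add: abs_mult)
    then show ?case using step.IH by linarith
  qed simp
  have "\<bar>affine_extension u y - affine_extension u x\<bar> \<le> Inf {l. cayley_path G S x l y}"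
    using cayley_path_exists[OF is_group S_carrier generate_S x y] path by (intro cInf_greatest) auto
  then show ?thesis using x y by (simp add: cayley_dist_def)
qed

lemma continuous_map_affine_extension:
  assumes u: "\<And>g h. g \<in> carrier G \<Longrightarrow> h \<in> carrier G \<Longrightarrow> wd g h \<le> 1 \<Longrightarrow> \<bar>u g - u h\<bar> \<le> 1"
  shows "continuous_map \<Gamma> euclideanreal (affine_extension u)"
proof -
  have "continuous_map X.mtopology Met_TC.mtopology (affine_extension u)"
    unfolding X.metric_continuous_map[OF Met_TC.Metric_space_axioms]
  proof (intro conjI ballI allI impI)
    fix x and \<epsilon> :: real assume "x \<in> cayley_points G S" "\<epsilon> > 0"
    then show "\<exists>\<delta>>0. \<forall>y. y \<in> cayley_points G S \<and> cayley_dist G S x y < \<delta> \<longrightarrow>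
        dist (affine_extension u x) (affine_extension u y) < \<epsilon>"
      using affine_extension_lipschitz[OF u]
      by (intro exI[of _ \<epsilon>]) (fastforce simp: dist_real_def abs_minus_commute)
  qed simp
  then show ?thesis
    by (simp add: cayley_graph_def mtopology_is_euclidean)
qed

lemma continuous_map_lipschitz_curve:
  assumes "\<And>t. t \<in> T \<Longrightarrow> r t \<in> cayley_points G S"
    and "\<And>s t. s \<in> T \<Longrightarrow> t \<in> T \<Longrightarrow> cayley_dist G S (r s) (r t) \<le> \<bar>t - s\<bar>"
  shows "continuous_map (top_of_set T) \<Gamma> r"
  unfolding cayley_graph_def X.continuous_map_to_metric
proof (intro ballI allI impI)
  fix s and \<epsilon> :: real assume s: "s \<in> topspace (top_of_set T)" and "\<epsilon> > 0"
  have "r t \<in> X.mball (r s) \<epsilon>" if "t \<in> T \<inter> ball s \<epsilon>" for t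
    using that assms(1)[of s] assms(1)[of t] assms(2)[of s t] s by (auto simp: dist_real_def abs_minus_commute)
  then show "\<exists>U. openin (top_of_set T) U \<and> s \<in> U \<and> (\<forall>t\<in>U. r t \<in> X.mball (r s) \<epsilon>)"
    using s \<open>\<epsilon> > 0\<close> by (intro exI[of _ "T \<inter> ball s \<epsilon>"]) (auto simp: openin_open_Int)
qed

lemma continuous_map_segment:
  assumes "g \<in> carrier G" "h \<in> carrier G" "wd g h \<le> 1"
  shows "continuous_map (top_of_set {0..1}) \<Gamma> (edge_point g h)"
  using segment_lipschitz[OF assms] by (intro continuous_map_lipschitz_curve) auto

section \<open>Height over the identity and a compact exhaustion\<close>

definition height :: "('a \<Rightarrow> real) \<Rightarrow> real" where
  "height = affine_extension (wd \<one>)"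

lemma height_edge: "height (edge_point g h t) = (1 - t) * wd \<one> g + t * wd \<one> h"
  by (simp add: height_def affine_extension_edge)

lemma height_edge_bounds:
  assumes "t \<in> {0..1}"
  shows "min (wd \<one> g) (wd \<one> h) \<le> height (edge_point g h t)"
    "height (edge_point g h t) \<le> max (wd \<one> g) (wd \<one> h)"
proof -
  have "(1 - t) * min (wd \<one> g) (wd \<one> h) + t * min (wd \<one> g) (wd \<one> h) \<le> (1 - t) * wd \<one> g + t * wd \<one> h"
    using assms by (intro add_mono mult_left_mono) auto
  then show "min (wd \<one> g) (wd \<one> h) \<le> height (edge_point g h t)"
    by (simp add: height_edge algebra_simps)
  have "(1 - t) * wd \<one> g + t * wd \<one> h \<le> (1 - t) * max (wd \<one> g) (wd \<one> h) + t * max (wd \<one> g) (wd \<one> h)"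
    using assms by (intro add_mono mult_left_mono) auto
  then show "height (edge_point g h t) \<le> max (wd \<one> g) (wd \<one> h)"
    by (simp add: height_edge algebra_simps)
qed

lemma word_norm_lipschitz:
  assumes "g \<in> carrier G" "h \<in> carrier G"
  shows "\<bar>wd \<one> g - wd \<one> h\<bar> \<le> wd g h"
  using W.triangle[of \<one> g h] W.triangle[of \<one> h g] W.commute[of g h] assms by simp

lemma continuous_map_height: "continuous_map \<Gamma> euclideanreal height"
  unfolding height_def using word_norm_lipschitz by (intro continuous_map_affine_extension) fastforce

lemma edge_norms_near_height:
  assumes "g \<in> carrier G" "h \<in> carrier G" "wd g h \<le> 1" "t \<in> {0..1}"
  shows "\<bar>wd \<one> g - height (edge_point g h t)\<bar> \<le> 1" "\<bar>wd \<one> h - height (edge_point g h t)\<bar> \<le> 1"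
  using height_edge_bounds[OF assms(4), of g h] word_norm_lipschitz[OF assms(1,2)] assms(3)
  by (auto simp: min_def max_def split: if_splits)

text \<open>A finite union of segments, hence compact. These sets exhaust the graph, so a proper ray
  must leave each of them.\<close>

definition thick_ball :: "real \<Rightarrow> ('a \<Rightarrow> real) set" where
  "thick_ball m = \<Union> ((\<lambda>(g, h). edge_point g h ` {0..1}) ` {(g, h) \<in> W.mcball \<one> m \<times> W.mcball \<one> m. wd g h \<le> 1})"

lemma compactin_thick_ball: "compactin \<Gamma> (thick_ball m)"
  unfolding thick_ball_def
proof (rule compactin_Union)
  show "finite ((\<lambda>(g, h). edge_point g h ` {0..1}) ` {(g, h) \<in> W.mcball \<one> m \<times> W.mcball \<one> m. wd g h \<le> 1})"
  proof (rule finite_imageI, rule finite_subset)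
    show "finite (W.mcball \<one> m \<times> W.mcball \<one> m)"
      by (intro finite_cartesian_product W.finite_mcball one_closed)
  qed blast
  fix E assume "E \<in> (\<lambda>(g, h). edge_point g h ` {0..1}) ` {(g, h) \<in> W.mcball \<one> m \<times> W.mcball \<one> m. wd g h \<le> 1}"
  then obtain g h where e: "g \<in> carrier G" "h \<in> carrier G" "wd g h \<le> 1"
    and E: "E = edge_point g h ` {0..1}"
    by auto
  have "compactin (top_of_set {0..1}) {0..1::real}"
    by (simp add: compactin_subtopology)
  then show "compactin \<Gamma> E"
    unfolding E by (rule image_compactin[OF _ continuous_map_segment[OF e]])
qed

text \<open>The unit is lost because an endpoint of an edge can be higher than the given point by up
  to 1.\<close>

lemma thick_ballI:
  assumes x: "x \<in> cayley_points G S" "height x \<le> m - 1"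
  shows "x \<in> thick_ball m"
proof -
  obtain g h t where e: "g \<in> carrier G" "h \<in> carrier G" "wd g h \<le> 1" "t \<in> {0..1}" "x = edge_point g h t"
    using cayley_points_cases[OF x(1)] .
  then have "wd \<one> g \<le> m" "wd \<one> h \<le> m"
    using edge_norms_near_height[OF e(1-4)] x(2) by auto
  then have "(g, h) \<in> {(g, h) \<in> W.mcball \<one> m \<times> W.mcball \<one> m. wd g h \<le> 1}"
    using e by auto
  then show ?thesis
    unfolding thick_ball_def e(5) by (rule UnionI[OF imageI]) (use e(4) in simp)
qed

lemma compactin_height_bounded:
  assumes "compactin \<Gamma> K"
  obtains R where "R \<ge> 0" "\<And>x. x \<in> K \<Longrightarrow> height x \<le> R"
proof -
  have "compact (height ` K)"
    using image_compactin[OF assms continuous_map_height] by simp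
  then obtain R where R: "\<And>y. y \<in> height ` K \<Longrightarrow> \<bar>y\<bar> \<le> R"
    using compact_imp_bounded by (metis bounded_iff real_norm_def)
  show ?thesis
    by (rule that[of "max 0 R"]) (use R in fastforce)+
qed

section \<open>Proper rays and path components at infinity\<close>

lemma proper_ray_in:
  assumes "proper_ray \<Gamma> r" "t \<ge> 0"
  shows "r t \<in> cayley_points G S"
  using assms continuous_map_image_subset_topspace[of "top_of_set {0..}" \<Gamma> r]
  by (auto simp: proper_ray_def topspace_cayley_graph)

lemma proper_ray_leaves:
  assumes "proper_ray \<Gamma> r" "compactin \<Gamma> K"
  obtains N :: nat where "\<And>t. t \<ge> real N \<Longrightarrow> r t \<notin> K"
proof -
  have "compactin (top_of_set {0..}) {t \<in> topspace (top_of_set {0..}). r t \<in> K}"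
    using assms compactin_proper_map_preimage unfolding proper_ray_def by blast
  then have "compact {t \<in> {0..}. r t \<in> K}"
    by (simp add: compactin_subtopology)
  then obtain R where R: "\<And>t. t \<in> {t \<in> {0..}. r t \<in> K} \<Longrightarrow> \<bar>t\<bar> \<le> R"
    using compact_imp_bounded by (metis (no_types, lifting) bounded_iff real_norm_def)
  obtain N :: nat where N: "R < real N" using reals_Archimedean2 by blast
  have "r t \<notin> K" if "t \<ge> real N" for t
    using R[of t] N that by fastforce
  then show ?thesis
    using that by blast
qed

lemma proper_ray_high:
  assumes "proper_ray \<Gamma> r"
  obtains N :: nat where "\<And>t. t \<ge> real N \<Longrightarrow> m < height (r t)"
proof -
  obtain N :: nat where N: "\<And>t. t \<ge> real N \<Longrightarrow> r t \<notin> thick_ball (m + 1)"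
    using proper_ray_leaves[OF assms compactin_thick_ball] by metis
  have "m < height (r t)" if "t \<ge> real N" for t
    using thick_ballI[of "r t" "m + 1"] N[OF that] proper_ray_in[OF assms, of t] that by force
  then show ?thesis using that by blast
qed

lemma proper_ray_tail:
  assumes r: "proper_ray \<Gamma> r" and K: "compactin \<Gamma> K"
  obtains N :: nat and C where "C \<in> path_components_of (subtopology \<Gamma> (topspace \<Gamma> - K))"
    "r ` {real N..} \<subseteq> C"
proof -
  obtain N :: nat where N: "\<And>t. t \<ge> real N \<Longrightarrow> r t \<notin> K"
    using proper_ray_leaves[OF r K] by metis
  let ?Y = "subtopology \<Gamma> (topspace \<Gamma> - K)"
  have "path_connectedin euclideanreal {real N..}"
    by (simp add: path_connectedin_iff_path_connected_real convex_imp_path_connected)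
  then have "path_connectedin (top_of_set {0..}) {real N..}"
    by (simp add: path_connectedin_subtopology)
  then have "path_connectedin \<Gamma> (r ` {real N..})"
    using r path_connectedin_continuous_map_image unfolding proper_ray_def by blast
  then have pc: "path_connectedin ?Y (r ` {real N..})"
    using N proper_ray_in[OF r] by (auto simp: path_connectedin_subtopology topspace_cayley_graph)
  have rN: "r (real N) \<in> r ` {real N..}" by simp
  have "r (real N) \<in> topspace ?Y"
    using N[of "real N"] proper_ray_in[OF r] by (simp add: topspace_cayley_graph)
  then have "path_component_of_set ?Y (r (real N)) \<in> path_components_of ?Y"
    by (simp add: path_component_in_path_components_of)
  then show ?thesis
    using that path_component_of_maximal[OF pc rN] by blast
qed

text \<open>The height on a segment is at least the smaller endpoint norm, so a segment with both
  ends above \<open>K\<close> avoids \<open>K\<close> and is path connected in the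
  complement.\<close>

lemma segment_in_path_component:
  assumes C: "C \<in> path_components_of (subtopology \<Gamma> (topspace \<Gamma> - K))"
    and K: "\<And>x. x \<in> K \<Longrightarrow> height x \<le> R"
    and e: "g \<in> carrier G" "h \<in> carrier G" "wd g h \<le> 1" "R < wd \<one> g" "R < wd \<one> h"
    and t: "t \<in> {0..1}" "edge_point g h t \<in> C" and t': "t' \<in> {0..1}"
  shows "edge_point g h t' \<in> C"
proof -
  have "path_connectedin euclideanreal {0..1::real}"
    by (simp add: path_connectedin_iff_path_connected_real convex_imp_path_connected)
  then have "path_connectedin (top_of_set {0..1}) {0..1::real}"
    by (simp add: path_connectedin_subtopology)
  then have "path_connectedin \<Gamma> (edge_point g h ` {0..1})"
    using continuous_map_segment[OF e(1-3)] path_connectedin_continuous_map_image by blast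
  moreover have "edge_point g h s \<in> topspace \<Gamma> - K" if s: "s \<in> {0..1}" for s
    using height_edge_bounds(1)[OF s, of g h] K[of "edge_point g h s"] e
      segment_lipschitz(1)[OF e(1-3) s s] by (auto simp: topspace_cayley_graph)
  ultimately have "path_connectedin (subtopology \<Gamma> (topspace \<Gamma> - K)) (edge_point g h ` {0..1})"
    by (simp add: path_connectedin_subtopology image_subset_iff)
  moreover have "\<not> disjnt C (edge_point g h ` {0..1})"
    using t by (auto simp: disjnt_iff)
  ultimately have "edge_point g h ` {0..1} \<subseteq> C"
    by (rule path_components_of_maximal[OF C])
  then show ?thesis using t' by blast
qed

text \<open>Running through the edges at unit speed gives a 1-Lipschitz curve whose height at time
  \<open>t\<close> is exactly \<open>t\<close>; the height is bounded on compact sets, so their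
  preimages are bounded.\<close>

lemma proper_ray_of_geodesic:
  assumes \<gamma>: "\<And>n. \<gamma> n \<in> carrier G" "\<And>n. wd \<one> (\<gamma> n) = real n" "\<And>n. wd (\<gamma> n) (\<gamma> (Suc n)) = 1"
  obtains r where "proper_ray \<Gamma> r" "\<And>n::nat. r (real n) = edge_point (\<gamma> n) (\<gamma> n) 0"
proof -
  define r where "r t = edge_point (\<gamma> (nat \<lfloor>t\<rfloor>)) (\<gamma> (Suc (nat \<lfloor>t\<rfloor>))) (t - real (nat \<lfloor>t\<rfloor>))" for t
  have fl: "t - real (nat \<lfloor>t\<rfloor>) \<in> {0..1}" "real (nat \<lfloor>t\<rfloor>) \<le> t" if "t \<ge> 0" for t
  proof -
    have "real (nat \<lfloor>t\<rfloor>) = of_int \<lfloor>t\<rfloor>" using that by simp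
    then show "t - real (nat \<lfloor>t\<rfloor>) \<in> {0..1}" "real (nat \<lfloor>t\<rfloor>) \<le> t"
      using floor_correct[of t] unfolding atLeastAtMost_iff by linarith+
  qed
  have rn: "r (real n) = edge_point (\<gamma> n) (\<gamma> n) 0" for n
    using edge_point_simps(1)[of "\<gamma> n" "\<gamma> (Suc n)"] by (simp add: r_def)
  have edge: "edge_point (\<gamma> n) (\<gamma> (Suc n)) s \<in> cayley_points G S"
    "cayley_dist G S (edge_point (\<gamma> n) (\<gamma> (Suc n)) s) (edge_point (\<gamma> n) (\<gamma> (Suc n)) t) \<le> \<bar>t - s\<bar>"
    if "s \<in> {0..1}" "t \<in> {0..1}" for n s t
    using segment_lipschitz[of "\<gamma> n" "\<gamma> (Suc n)" s t] \<gamma> that by auto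
  have rP: "r t \<in> cayley_points G S" if "t \<ge> 0" for t
    unfolding r_def using edge(1) fl(1)[OF that] by blast
  \<comment> \<open>Induction on the number \<open>k\<close> of integer times passed: within one
    edge the bound is that of a segment, and the pieces are joined at the vertices.\<close>
  have lip: "cayley_dist G S (r s) (r t) \<le> t - s"
    if "0 \<le> s" "s \<le> t" "nat \<lfloor>t\<rfloor> = nat \<lfloor>s\<rfloor> + k" for s t k
    using that
  proof (induction k arbitrary: s)
    case 0
    then show ?case
      using edge(2)[OF fl(1)[of s] fl(1)[of t], of "nat \<lfloor>s\<rfloor>"] by (simp add: r_def)
  next
    case (Suc k)
    let ?m = "Suc (nat \<lfloor>s\<rfloor>)"
    have "r (real ?m) = edge_point (\<gamma> (nat \<lfloor>s\<rfloor>)) (\<gamma> ?m) 1"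
      unfolding rn by (simp only: edge_point_simps(2))
    then have "cayley_dist G S (r s) (r (real ?m)) \<le> \<bar>1 - (s - real (nat \<lfloor>s\<rfloor>))\<bar>"
      using edge(2)[OF fl(1)[of s], of 1 "nat \<lfloor>s\<rfloor>"] Suc.prems by (simp add: r_def)
    also have "\<dots> = real ?m - s"
      using fl(1)[of s] Suc.prems by auto
    finally have 1: "cayley_dist G S (r s) (r (real ?m)) \<le> real ?m - s" .
    have mt: "real ?m \<le> t"
      using fl(2)[of t] Suc.prems by simp
    have "nat \<lfloor>real ?m\<rfloor> = ?m"
      by (simp only: floor_of_nat nat_int)
    then have "nat \<lfloor>t\<rfloor> = nat \<lfloor>real ?m\<rfloor> + k"
      using Suc.prems(3) by simp
    then have "cayley_dist G S (r (real ?m)) (r t) \<le> t - real ?m"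
      by (rule Suc.IH[OF of_nat_0_le_iff mt])
    then show ?case
      using X.triangle[OF rP[of s] rP[of "real ?m"] rP[of t]] 1 Suc.prems by simp
  qed
  have lip': "cayley_dist G S (r s) (r t) \<le> t - s" if "0 \<le> s" "s \<le> t" for s t
    using lip[of s t "nat \<lfloor>t\<rfloor> - nat \<lfloor>s\<rfloor>"] that by (simp add: nat_mono floor_mono)
  have cont: "continuous_map (top_of_set {0..}) \<Gamma> r"
  proof (rule continuous_map_lipschitz_curve)
    show "cayley_dist G S (r s) (r t) \<le> \<bar>t - s\<bar>" if "s \<in> {0..}" "t \<in> {0..}" for s t
      using lip'[of s t] lip'[of t s] X.commute[of "r s" "r t"] that by (cases "s \<le> t") auto
  qed (use rP in auto)
  have height: "height (r t) = t" if "t \<ge> 0" for t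
    unfolding r_def height_edge \<gamma>(2) by (simp add: algebra_simps)
  have "proper_map (top_of_set {0..}) \<Gamma> r"
  proof (rule compact_imp_proper_map)
    show "k_space \<Gamma>"
      by (simp add: cayley_graph_def X.k_space_mtopology)
    show "kc_space \<Gamma>"
      by (simp add: Hausdorff_cayley_graph Hausdorff_imp_kc_space)
    show "r \<in> topspace (top_of_set {0..}) \<rightarrow> topspace \<Gamma>"
      using rP by (auto simp: topspace_cayley_graph)
    fix K assume K: "compactin \<Gamma> K"
    obtain R where R: "\<And>x. x \<in> K \<Longrightarrow> height x \<le> R"
      using compactin_height_bounded[OF K] by metis
    have "closedin (top_of_set {0..}) {t \<in> topspace (top_of_set {0..}). r t \<in> K}"
      using closedin_continuous_map_preimage[OF cont] compactin_imp_closedin[OF Hausdorff_cayley_graph K] .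
    moreover have "{t \<in> topspace (top_of_set {0..}). r t \<in> K} \<subseteq> {0..R}"
      using R height by fastforce
    moreover have "compactin (top_of_set {0..}) {0..R}"
      by (simp add: compactin_subtopology)
    ultimately show "compactin (top_of_set {0..}) {t \<in> topspace (top_of_set {0..}). r t \<in> K}"
      by (meson closed_compactin)
  qed (use cont in simp)
  then show ?thesis
    using that[of r] cont rn by (simp add: proper_ray_def)
qed

section \<open>One end and unsplittability\<close>

lemma same_end_refl:
  assumes "proper_ray \<Gamma> r"
  shows "same_end \<Gamma> r r"
  unfolding same_end_def using proper_ray_tail[OF assms] by metis

text \<open>Reflexivity carries the forward direction: with a single class, \<open>r'\<close> lies
  in its own class, which is that of \<open>r\<close>. Cardinality 1 also excludes the empty
  quotient and, by the convention for \<open>card\<close>, an infinite one.\<close>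

lemma card_ends_eq_1_iff:
  "card (ends_of_group G S) = 1 \<longleftrightarrow>
     (\<exists>r. proper_ray \<Gamma> r) \<and> (\<forall>r r'. proper_ray \<Gamma> r \<longrightarrow> proper_ray \<Gamma> r' \<longrightarrow> same_end \<Gamma> r r')"
proof -
  define Q where "Q = {r. proper_ray \<Gamma> r}"
  define E where "E = {(r, r'). proper_ray \<Gamma> r \<and> proper_ray \<Gamma> r' \<and> same_end \<Gamma> r r'}"
  have ends: "ends_of_group G S = Q // E"
    by (simp add: ends_of_group_def ends_of_space_def Q_def E_def)
  have "card (Q // E) = 1 \<longleftrightarrow> Q \<noteq> {} \<and> (\<forall>r\<in>Q. \<forall>r'\<in>Q. (r, r') \<in> E)"
  proof
    assume "card (Q // E) = 1"
    then obtain C where C: "Q // E = {C}"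
      by (rule card_1_singletonE)
    have class_eq: "E `` {r} = C" if "r \<in> Q" for r
      using quotientI[OF that, of E] unfolding C by simp
    have "(r, r') \<in> E" if "r \<in> Q" "r' \<in> Q" for r r'
    proof -
      have "r' \<in> E `` {r'}"
        using that same_end_refl by (simp add: Q_def E_def)
      then have "r' \<in> E `` {r}"
        using class_eq that by simp
      then show ?thesis by simp
    qed
    moreover have "Q \<noteq> {}" using C by auto
    ultimately show "Q \<noteq> {} \<and> (\<forall>r\<in>Q. \<forall>r'\<in>Q. (r, r') \<in> E)" by blast
  next
    assume r: "Q \<noteq> {} \<and> (\<forall>r\<in>Q. \<forall>r'\<in>Q. (r, r') \<in> E)"
    then have "E `` {r} = Q" if "r \<in> Q" for r
      using that by (auto simp: Q_def E_def)
    then have "Q // E = {Q}"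
      using r by (auto simp: quotient_def)
    then show "card (Q // E) = 1" by simp
  qed
  then show ?thesis
    unfolding ends by (auto simp: Q_def E_def)
qed

text \<open>Were there finitely many such vertices, the ray would eventually run above all of them,
  on an edge that lies wholly in \<open>C\<close> and whose endpoints are then further vertices of
  \<open>C\<close>.\<close>

lemma vertices_of_end_infinite:
  assumes r: "proper_ray \<Gamma> r" and K: "\<And>x. x \<in> K \<Longrightarrow> height x \<le> R"
    and C: "C \<in> path_components_of (subtopology \<Gamma> (topspace \<Gamma> - K))" "r ` {real N..} \<subseteq> C"
  shows "infinite {g \<in> carrier G. edge_point g g 0 \<in> C}"
proof
  assume "finite {g \<in> carrier G. edge_point g g 0 \<in> C}" (is "finite ?V")
  \<comment> \<open>Including \<open>R\<close> keeps the edge found at height above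
    \<open>m + 1\<close> clear of \<open>K\<close>; the extra 1 allows for its lower
    endpoint.\<close>
  define m where "m = Max (insert R (wd \<one> ` ?V))"
  have m: "R \<le> m" "\<And>g. g \<in> ?V \<Longrightarrow> wd \<one> g \<le> m"
    using \<open>finite ?V\<close> by (auto simp: m_def)
  obtain N' :: nat where N': "\<And>t. t \<ge> real N' \<Longrightarrow> m + 1 < height (r t)"
    using proper_ray_high[OF r] by metis
  let ?t = "real (max N N')"
  have high: "m + 1 < height (r ?t)" "r ?t \<in> C"
    using N'[of ?t] C(2) by auto
  obtain g h s where e: "g \<in> carrier G" "h \<in> carrier G" "wd g h \<le> 1" "s \<in> {0..1}" "r ?t = edge_point g h s"
    using cayley_points_cases[OF proper_ray_in[OF r, of ?t]] by auto
  have gh: "m < wd \<one> g" "m < wd \<one> h"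
    using edge_norms_near_height[OF e(1-4)] high(1) e(5) by auto
  then have "edge_point g h 0 \<in> C"
    using segment_in_path_component[OF C(1) K e(1-3) _ _ e(4)] m(1) high(2) e(5) by simp
  then have "g \<in> ?V"
    using e(1) edge_point_simps(1)[of g h] by simp
  then show False
    using m(2) gh by force
qed

theorem card_ends_eq_1_iff_unsplittable:
  "card (ends_of_group G S) = 1 \<longleftrightarrow> infinite (carrier G) \<and> W.unsplittable (carrier G)"
proof
  assume c: "infinite (carrier G) \<and> W.unsplittable (carrier G)"
  obtain \<gamma> where \<gamma>: "\<And>n. \<gamma> n \<in> carrier G" "\<And>n. wd \<one> (\<gamma> n) = real n" "\<And>n. wd (\<gamma> n) (\<gamma> (Suc n)) = 1"
    using W.geodesic_ray[OF one_closed order_refl, of thesis] c by blast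
  then have ex: "\<exists>r. proper_ray \<Gamma> r"
    using proper_ray_of_geodesic[of \<gamma>] by metis
  have "same_end \<Gamma> r r'" if r: "proper_ray \<Gamma> r" "proper_ray \<Gamma> r'" for r r'
    unfolding same_end_def
  proof (intro allI impI)
    fix K assume K: "compactin \<Gamma> K"
    let ?PC = "path_components_of (subtopology \<Gamma> (topspace \<Gamma> - K))"
    obtain R where R: "R \<ge> 0" "\<And>x. x \<in> K \<Longrightarrow> height x \<le> R"
      using compactin_height_bounded[OF K] by blast
    obtain N C where C: "C \<in> ?PC" "r ` {real N..} \<subseteq> C"
      using proper_ray_tail[OF r(1) K] .
    obtain N' C' where C': "C' \<in> ?PC" "r' ` {real N'..} \<subseteq> C'"
      using proper_ray_tail[OF r(2) K] .
    define V where "V D = {g \<in> carrier G. edge_point g g 0 \<in> D}" for D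
    have inf: "infinite (V C)" "infinite (V C')"
      unfolding V_def using vertices_of_end_infinite[OF r(1) R(2) C] vertices_of_end_infinite[OF r(2) R(2) C']
      by blast+
    \<comment> \<open>Adjacent vertices above \<open>R\<close> lie in the same path component. The
      radius is \<open>R + 1\<close> because the neighbour of \<open>x\<close> can be one unit
      lower.\<close>
    have "{x \<in> V C. \<exists>y\<in>carrier G - V C. wd x y \<le> 1} \<subseteq> W.mcball \<one> (R + 1)"
    proof
      fix x assume "x \<in> {x \<in> V C. \<exists>y\<in>carrier G - V C. wd x y \<le> 1}"
      then obtain y where xy: "x \<in> carrier G" "edge_point x x 0 \<in> C" "y \<in> carrier G"
        "edge_point y y 0 \<notin> C" "wd x y \<le> 1"
        by (auto simp: V_def)
      have "\<not> R + 1 < wd \<one> x"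
      proof
        assume big: "R + 1 < wd \<one> x"
        then have "R < wd \<one> x" "R < wd \<one> y"
          using word_norm_lipschitz[OF xy(1,3)] xy(5) by auto
        then have "edge_point x y 1 \<in> C"
          using segment_in_path_component[OF C(1) R(2) xy(1,3,5), of 0 1] xy(2)
            edge_point_simps(1)[of x y] by simp
        then show False
          using xy(4) edge_point_simps(2)[of x y] by simp
      qed
      then show "x \<in> W.mcball \<one> (R + 1)"
        using xy by simp
    qed
    then have boundary: "finite {x \<in> V C. \<exists>y\<in>carrier G - V C. wd x y \<le> 1}"
      using W.finite_mcball[OF one_closed] by (rule finite_subset)
    have "V C \<subseteq> carrier G"
      by (auto simp: V_def)
    then have fin: "finite (carrier G - V C)"
      using c[THEN conjunct2, unfolded W.unsplittable_def, rule_format, OF _ boundary] inf(1) by simp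
    \<comment> \<open>The vertices of \<open>C\<close> are cofinite, so they leave no room for the
      infinitely many vertices of a disjoint component.\<close>
    have "C = C'"
    proof (rule ccontr)
      assume "C \<noteq> C'"
      then have "C \<inter> C' = {}"
        using path_components_of_overlap[OF C(1) C'(1)] by blast
      then have "V C' \<subseteq> carrier G - V C"
        by (auto simp: V_def)
      then show False
        using fin inf(2) finite_subset by blast
    qed
    then have "r ` {real (max N N')..} \<subseteq> C" "r' ` {real (max N N')..} \<subseteq> C"
      using C(2) C'(2) by (auto simp: image_subset_iff)
    then show "\<exists>N::nat. \<exists>C\<in>?PC. r ` {real N..} \<subseteq> C \<and> r' ` {real N..} \<subseteq> C"
      using C(1) by blast
  qed
  then show "card (ends_of_group G S) = 1"
    using ex card_ends_eq_1_iff by blast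
next
  assume "card (ends_of_group G S) = 1"
  then obtain r where r: "proper_ray \<Gamma> r"
    and same: "\<And>r r'. proper_ray \<Gamma> r \<Longrightarrow> proper_ray \<Gamma> r' \<Longrightarrow> same_end \<Gamma> r r'"
    using card_ends_eq_1_iff by blast
  have "infinite (carrier G)"
  proof -
    obtain N C where C: "C \<in> path_components_of (subtopology \<Gamma> (topspace \<Gamma> - {}))" "r ` {real N..} \<subseteq> C"
      using proper_ray_tail[OF r compactin_empty] .
    have "infinite {g \<in> carrier G. edge_point g g 0 \<in> C}"
      by (rule vertices_of_end_infinite[OF r _ C]) simp
    then show ?thesis
      using finite_subset[of "{g \<in> carrier G. edge_point g g 0 \<in> C}" "carrier G"] by blast
  qed
  moreover have "W.unsplittable (carrier G)"
    unfolding W.unsplittable_def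
  proof (intro allI impI)
    fix A assume A: "A \<subseteq> carrier G" and fin: "finite {x \<in> A. \<exists>y\<in>carrier G - A. wd x y \<le> 1}" (is "finite ?E")
    show "finite A \<or> finite (carrier G - A)"
    proof (rule ccontr)
      assume "\<not> ?thesis"
      then have inf: "infinite A" "infinite (carrier G - A)" by auto
      define R where "R = Max (insert 0 (wd \<one> ` ?E))"
      have R: "wd \<one> x \<le> R" if "x \<in> ?E" for x
        unfolding R_def using fin that by (intro Max_ge) auto
      have side: "x \<in> A \<longleftrightarrow> y \<in> A"
        if "x \<in> carrier G" "y \<in> carrier G" "wd x y \<le> 1" "R < wd \<one> x" "R < wd \<one> y" for x y
      proof -
        have "wd y x \<le> 1" using that W.commute by simp
        then have "x \<in> ?E \<or> y \<in> ?E \<or> (x \<in> A \<longleftrightarrow> y \<in> A)"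
          using that by blast
        then show ?thesis using R[of x] R[of y] that by linarith
      qed
      \<comment> \<open>The norm condition makes the geodesic from \<open>x\<close> to
        \<open>a\<close> move straight away from the identity, so it starts and remains beyond the
        boundary of \<open>A\<close>.\<close>
      have side_geodesic: "x \<in> A \<longleftrightarrow> a \<in> A"
        if "x \<in> carrier G" "a \<in> carrier G" "R < wd \<one> x" "wd \<one> a = wd \<one> x + real n" "wd x a = real n"
        for x a n
        using that
      proof (induction n arbitrary: x)
        case 0
        have "x = a" using W.zero[OF 0(1,2)] 0(5) by simp
        then show ?case by (rule arg_cong)
      next
        case (Suc n)
        have "x \<noteq> a" using Suc.prems(1,5) by auto
        then obtain z where z: "z \<in> carrier G" "wd x z = 1" "wd z a = real n"
          using W.dist_step[of x a] Suc.prems(1,2,5) by auto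
        have "wd \<one> z \<le> wd \<one> x + wd x z" "wd \<one> a \<le> wd \<one> z + wd z a"
          using W.triangle[of \<one> x z] W.triangle[of \<one> z a] Suc.prems(1,2) z(1) by simp_all
        then have "wd \<one> z = wd \<one> x + 1"
          using z Suc.prems by simp
        then have "z \<in> A \<longleftrightarrow> a \<in> A" "x \<in> A \<longleftrightarrow> z \<in> A"
          using Suc.IH[of z] side[of x z] z Suc.prems by simp_all
        then show ?case by simp
      qed
      \<comment> \<open>Koenig's lemma leaves a point of \<open>D\<close> behind every
        \<open>\<gamma> n\<close>. Taking \<open>D\<close> to be \<open>A\<close> or its complement
        thus fixes the side on which the ray ends up.\<close>
      have ray: "\<exists>r \<gamma>. proper_ray \<Gamma> r \<and> (\<forall>n. \<gamma> n \<in> carrier G \<and> r (real n) = edge_point (\<gamma> n) (\<gamma> n) 0 \<and>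
          (real n > R \<longrightarrow> (\<exists>a\<in>D. \<gamma> n \<in> A \<longleftrightarrow> a \<in> A)))"
        if D: "D \<subseteq> carrier G" "infinite D" for D
      proof -
        obtain \<gamma> where \<gamma>: "\<And>n. \<gamma> n \<in> carrier G" "\<And>n. wd \<one> (\<gamma> n) = real n"
          "\<And>n. wd (\<gamma> n) (\<gamma> (Suc n)) = 1" "\<And>n. \<exists>a\<in>D. wd \<one> a = real n + wd (\<gamma> n) a"
          using W.geodesic_ray[OF one_closed D] by blast
        obtain r where r: "proper_ray \<Gamma> r" "\<And>n::nat. r (real n) = edge_point (\<gamma> n) (\<gamma> n) 0"
          using proper_ray_of_geodesic[OF \<gamma>(1-3)] by blast
        have "\<exists>a\<in>D. \<gamma> n \<in> A \<longleftrightarrow> a \<in> A" if "real n > R" for n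
        proof -
          obtain a where a: "a \<in> D" "wd \<one> a = real n + wd (\<gamma> n) a"
            using \<gamma>(4) by blast
          obtain k where "wd (\<gamma> n) a = real k"
            using W.dist_Nats[OF \<gamma>(1)[of n], of a] a D by (metis Nats_cases subsetD)
          then have "\<gamma> n \<in> A \<longleftrightarrow> a \<in> A"
            using side_geodesic[of "\<gamma> n" a k] \<gamma>(1,2) a D that by auto
          then show ?thesis using a(1) by blast
        qed
        then show ?thesis using r \<gamma>(1) by blast
      qed
      obtain r\<^sub>1 \<gamma>\<^sub>1 where r1: "proper_ray \<Gamma> r\<^sub>1" "\<And>n. \<gamma>\<^sub>1 n \<in> carrier G"
        "\<And>n. r\<^sub>1 (real n) = edge_point (\<gamma>\<^sub>1 n) (\<gamma>\<^sub>1 n) 0" "\<And>n. real n > R \<Longrightarrow> \<gamma>\<^sub>1 n \<in> A"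
        using ray[OF A inf(1)] by blast
      obtain r\<^sub>2 \<gamma>\<^sub>2 where r2: "proper_ray \<Gamma> r\<^sub>2" "\<And>n. \<gamma>\<^sub>2 n \<in> carrier G"
        "\<And>n. r\<^sub>2 (real n) = edge_point (\<gamma>\<^sub>2 n) (\<gamma>\<^sub>2 n) 0" "\<And>n. real n > R \<Longrightarrow> \<gamma>\<^sub>2 n \<notin> A"
        using ray[OF Diff_subset inf(2)] by blast
      \<comment> \<open>One unit is lost in passing to heights above \<open>R + 1\<close>, another
        in passing to edges with both endpoints above \<open>R\<close>.\<close>
      let ?K = "thick_ball (R + 2)"
      let ?Y = "subtopology \<Gamma> (topspace \<Gamma> - ?K)"
      obtain N C where C: "C \<in> path_components_of ?Y" "r\<^sub>1 ` {real N..} \<subseteq> C" "r\<^sub>2 ` {real N..} \<subseteq> C"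
        using same[OF r1(1) r2(1)] compactin_thick_ball[of "R + 2"] unfolding same_end_def by blast
      \<comment> \<open>On the connected set \<open>C\<close> this continuous function takes the
        values 1 and 0, so it takes 1/2. That happens only on an edge with endpoints on different
        sides, and outside \<open>?K\<close> there is none.\<close>
      let ?F = "affine_extension (\<lambda>g. of_bool (g \<in> A))"
      have contF: "continuous_map \<Gamma> euclideanreal ?F"
        by (rule continuous_map_affine_extension) auto
      have "connectedin ?Y C"
        using C(1) path_connectedin_path_components_of path_connectedin_imp_connectedin by blast
      then have CY: "connectedin \<Gamma> C" "C \<subseteq> topspace \<Gamma> - ?K"
        by (simp_all add: connectedin_subtopology)
      have "connected (?F ` C)"
        using connectedin_continuous_map_image[OF contF CY(1)] by simp
      moreover obtain n :: nat where n: "real n > max R (real N)"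
        using reals_Archimedean2 by blast
      have "?F (r\<^sub>1 (real n)) = 1" "?F (r\<^sub>2 (real n)) = 0"
        using r1(3,4)[of n] r2(3,4)[of n] n by (simp_all add: affine_extension_edge)
      moreover have "r\<^sub>1 (real n) \<in> C" "r\<^sub>2 (real n) \<in> C"
        using C(2,3) n by auto
      ultimately have "1/2 \<in> ?F ` C"
        using connectedD_interval[of "?F ` C" 0 1 "1/2"] by force
      then obtain x where x: "x \<in> C" "?F x = 1/2" by force
      then have xP: "x \<in> cayley_points G S" "x \<notin> ?K"
        using CY(2) by (auto simp: topspace_cayley_graph)
      then have high: "R + 1 < height x"
        using thick_ballI[of x "R + 2"] by force
      obtain g h t where e: "g \<in> carrier G" "h \<in> carrier G" "wd g h \<le> 1" "t \<in> {0..1}" "x = edge_point g h t"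
        using cayley_points_cases[OF xP(1)] .
      have "R < wd \<one> g" "R < wd \<one> h"
        using edge_norms_near_height[OF e(1-4)] high e(5) by auto
      then have "g \<in> A \<longleftrightarrow> h \<in> A"
        using side e by blast
      then have "?F x = of_bool (g \<in> A)"
        unfolding e(5) affine_extension_edge by simp
      then show False
        using x(2) by (cases "g \<in> A") simp_all
    qed
  qed
  ultimately show "infinite (carrier G) \<and> W.unsplittable (carrier G)" by blast
qed

text \<open>Left translations are isometries of the word metric and act transitively on the
  group.\<close>

lemma word_dist_homogeneous:
  assumes "x \<in> carrier G" "y \<in> carrier G"
  shows "\<exists>t. t x = y \<and> (\<forall>a\<in>carrier G. t a \<in> carrier G) \<and> (\<forall>a\<in>carrier G. \<forall>b\<in>carrier G. wd (t a) (t b) = wd a b)"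
proof (intro exI[of _ "\<lambda>a. y \<otimes> inv x \<otimes> a"] conjI ballI)
  let ?t = "\<lambda>a. y \<otimes> inv x \<otimes> a"
  show "?t x = y" using assms by (simp add: m_assoc)
  show "?t a \<in> carrier G" if "a \<in> carrier G" for a
    using assms that by simp
  show "wd (?t a) (?t b) = wd a b" if "a \<in> carrier G" "b \<in> carrier G" for a b
    using assms that by (simp add: word_dist_left_mult)
qed

end

theorem theorem4p2:
  fixes G :: "('a, 'b) monoid_scheme" and S :: "'a set"
  assumes "group G"
    and "finite S" and "S \<subseteq> carrier G" and "generate G S = carrier G"
  shows "card (ends_of_group G S) = 1 \<longleftrightarrow>
           continuum (Metric_space.higson_corona (carrier G) (word_dist G S)) \<and>
           decomposable (Metric_space.higson_corona (carrier G) (word_dist G S))"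
proof -
  interpret cayley_graph_of_group G S
    by (intro cayley_graph_of_group.intro cayley_graph_of_group_axioms.intro assms)
  show ?thesis
    using card_ends_eq_1_iff_unsplittable W.continuum_higson_corona_iff
      W.decomposable_higson_corona[OF _ _ word_dist_homogeneous] by blast
qed

end
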